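(* Let $k_1,k_2,k_3\in\mathbb{Z}_{\ge0}$. Each matrix $M_{p/q}$ ($p/q\in\mathbb{Q}\cap[0,\infty)$ or $p/q=1/0$) is a $(k_1,k_2,k_3)$-CMM matrix, and for each vertex $(\frac pq,\frac{p+r}{q+s},\frac rs)$ of the Farey tree, $(M_{p/q},M_{(p+r)/(q+s)},M_{r/s})$ is a $(k_1,k_2,k_3)$-CMM triple.
   Context: Indeterminates $x_1,x_2,x_3$; $\mathbf{x}^{(v_1,v_2,v_3)}=x_1^{v_1}x_2^{v_2}x_3^{v_3}$; $\widehat{x_1}=x_2/x_3$, $\widehat{x_2}=x_3/x_1$, $\widehat{x_3}=x_1/x_2$; $\mathscr{M}=\frac{x_1^2+x_2^2+x_3^2+k_1x_2x_3+k_2x_1x_3+k_3x_1x_2}{x_1x_2x_3}$, $T=\begin{bmatrix}-1&0\\ \mathscr{M}&-1\end{bmatrix}$. Cluster structure: mutations $\mu_1(a,b,c)=(\frac{b^2+k_1bc+c^2}{a},b,c)$, $\mu_2(a,b,c)=(a,\frac{a^2+k_2ac+c^2}{b},c)$, $\mu_3(a,b,c)=(a,b,\frac{a^2+k_3ab+b^2}{c})$; labeled clusters: triples obtained from $(x_1,x_2,x_3)$ by finitely many mutations; non-labeled clusters: their permutations; cluster variables: their entries; a cluster variable $y$ occurs in a unique position $i$ and has parity $k_y:=k_i$. A CMM matrix is $X\in SL(2,\mathbb{Z}[x_1^{\pm1},x_2^{\pm1},x_3^{\pm1}])$ whose $(1,2)$-entry $x_{12}$ is a cluster variable with $\mathrm{tr}X=-k_{x_{12}}$;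 a CMM triple is a triple $(X,Y,Z)$ of CMM matrices with $XYZ=T$ and $(x_{12},y_{12},z_{12})$ a non-labeled cluster. Farey tree: root $(\frac01,\frac11,\frac10)$; vertex $(\frac ab,\frac cd,\frac ef)$ has children $(\frac ab,\frac{a+c}{b+d},\frac cd)$ and $(\frac cd,\frac{c+e}{d+f},\frac ef)$. Posets: fence posets with chronological ordering $\mathcal{P}(1),\dots,\mathcal{P}(h)$ (consecutive elements comparable, order = transitive closure), $L=\mathcal{P}(1)$, $R=\mathcal{P}(h)$; $\mathcal{W}(\mathcal{P})=\sum_I\prod_{x\in I}\mathrm{wt}(x)$ over order ideals $I$; $\mathcal{W}(\mathcal{P};\neg L)$, $\mathcal{W}(\mathcal{P};\neg R)$, $\mathcal{W}(\mathcal{P};\neg L,\neg R)$ restrict to ideals avoiding the indicated elements. For coprime $p,q>0$, $\mathcal{P}_{p/q}$: $\Lambda$ = lattice segments $(m,n)$–$(m+1,n)$ (label $x_3$), $(m,n)$–$(m,n+1)$ (label $x_2$), $(m,n+1)$–$(m+1,n)$ (label $x_1$); $\gamma$ from $(0,0)$ to $(q,p)$ crosses $\tau_1,\dots,\tau_m\in\Lambda$ away from its endpoints, in order; left/right w.r.t. direction of travel. For $\tau_j$ labeled $x_a$: one element of weight $\widehat{x_a}^2$ if $k_a=0$, else two consecutive elements, the first greater iff $\gamma$ crosses $\tau_j$ strictly closer to its right endpoint, the smaller weighted $k_a\widehat{x_a}$, the larger $\widehat{x_a}/k_a$; between the last element of $\tau_j$'s group and the first of $\tau_{j+1}$'s group,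 the former is greater iff their shared endpoint lies right of $\gamma$. $\mathbf{g}_{p/q}=(q-p-1,1-q,p+1)^\top$, $\mathbf{g}^\circ_{p/q}=(q-p,-q,p)^\top$. Matrices: $M_{0/1}=\begin{bmatrix}\frac{x_1}{x_2}&x_3\\-\frac{x_1^2}{x_2^2x_3}\left(1+k_3\frac{x_2}{x_1}+\frac{x_2^2}{x_1^2}\right)&-\frac{x_1}{x_2}-k_3\end{bmatrix}$, $M_{1/0}=\begin{bmatrix}-k_2&x_2\\-\frac1{x_2}&0\end{bmatrix}$, and for $p/q\in\mathbb{Q}\cap(0,\infty)$, $M_{p/q}=\begin{bmatrix}\mathbf{x}^{\mathbf{g}^\circ_{p/q}}\mathcal{W}(\mathcal{P}_{p/q};\neg L)&\mathbf{x}^{\mathbf{g}_{p/q}}\mathcal{W}(\mathcal{P}_{p/q})\\-\mathbf{x}^{2\mathbf{g}^\circ_{p/q}-\mathbf{g}_{p/q}}\mathcal{W}(\mathcal{P}_{p/q};\neg L,\neg R)&-\mathbf{x}^{\mathbf{g}^\circ_{p/q}}\mathcal{W}(\mathcal{P}_{p/q};\neg R)\end{bmatrix}$. *)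

theory Defs
  imports
    "HOL-Analysis.Analysis"
    "HOL-Computational_Algebra.Polynomial"
    "HOL-Computational_Algebra.Fraction_Field"
begin

section \<open>Rational functions and Laurent polynomials in three indeterminates\<close>

text \<open>Everything takes place in the field of fractions of the integral domain
  \<open>\<int>[x\<^sub>1][x\<^sub>2][x\<^sub>3]\<close>; the innermost polynomial variable is \<open>x\<^sub>1\<close>.\<close>

type_synonym ratfun = "int poly poly poly fract"

definition x\<^sub>1 :: ratfun where "x\<^sub>1 = Fract [:[:[:0, 1:]:]:] 1"
definition x\<^sub>2 :: ratfun where "x\<^sub>2 = Fract [:[:0, 1:]:] 1"
definition x\<^sub>3 :: ratfun where "x\<^sub>3 = Fract [:0, 1:] 1"

text \<open>The ring \<open>\<int>[x\<^sub>1\<^sup>\<plusminus>\<^sup>1, x\<^sub>2\<^sup>\<plusminus>\<^sup>1, x\<^sub>3\<^sup>\<plusminus>\<^sup>1]\<close>, as the subring of the field generated by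
  the indeterminates and their inverses.\<close>

inductive_set laurent :: "ratfun set" where
  const: "of_int c \<in> laurent"
| var: "y \<in> {x\<^sub>1, x\<^sub>2, x\<^sub>3} \<Longrightarrow> y \<in> laurent"
| var_inverse: "y \<in> {x\<^sub>1, x\<^sub>2, x\<^sub>3} \<Longrightarrow> inverse y \<in> laurent"
| add: "f \<in> laurent \<Longrightarrow> g \<in> laurent \<Longrightarrow> f + g \<in> laurent"
| mult: "f \<in> laurent \<Longrightarrow> g \<in> laurent \<Longrightarrow> f * g \<in> laurent"

definition monomial :: "int^3 \<Rightarrow> ratfun" where
  "monomial v = x\<^sub>1 powi (v $ 1) * x\<^sub>2 powi (v $ 2) * x\<^sub>3 powi (v $ 3)"

definition xhat :: "ratfun^3" where
  "xhat = vector [x\<^sub>2 / x\<^sub>3, x\<^sub>3 / x\<^sub>1, x\<^sub>1 / x\<^sub>2]"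


section \<open>Clusters\<close>

definition mu1 :: "nat^3 \<Rightarrow> ratfun^3 \<Rightarrow> ratfun^3" where
  "mu1 k c = (let a = c $ 1; b = c $ 2; d = c $ 3
              in vector [(b^2 + of_nat (k $ 1) * b * d + d^2) / a, b, d])"

definition mu2 :: "nat^3 \<Rightarrow> ratfun^3 \<Rightarrow> ratfun^3" where
  "mu2 k c = (let a = c $ 1; b = c $ 2; d = c $ 3
              in vector [a, (a^2 + of_nat (k $ 2) * a * d + d^2) / b, d])"

definition mu3 :: "nat^3 \<Rightarrow> ratfun^3 \<Rightarrow> ratfun^3" where
  "mu3 k c = (let a = c $ 1; b = c $ 2; d = c $ 3
              in vector [a, b, (a^2 + of_nat (k $ 3) * a * b + b^2) / d])"

inductive_set labeled_clusters :: "nat^3 \<Rightarrow> (ratfun^3) set" for k :: "nat^3" where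
  initial: "vector [x\<^sub>1, x\<^sub>2, x\<^sub>3] \<in> labeled_clusters k"
| mut1: "c \<in> labeled_clusters k \<Longrightarrow> mu1 k c \<in> labeled_clusters k"
| mut2: "c \<in> labeled_clusters k \<Longrightarrow> mu2 k c \<in> labeled_clusters k"
| mut3: "c \<in> labeled_clusters k \<Longrightarrow> mu3 k c \<in> labeled_clusters k"

definition nonlabeled_clusters :: "nat^3 \<Rightarrow> (ratfun^3) set" where
  "nonlabeled_clusters k = {(\<chi> i. c $ \<sigma> i) | c \<sigma>. c \<in> labeled_clusters k \<and> bij \<sigma>}"

definition occurs_at :: "nat^3 \<Rightarrow> ratfun \<Rightarrow> 3 \<Rightarrow> bool" where
  "occurs_at k y i \<longleftrightarrow> (\<exists>c \<in> labeled_clusters k. c $ i = y)"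

definition cluster_variable :: "nat^3 \<Rightarrow> ratfun \<Rightarrow> bool" where
  "cluster_variable k y \<longleftrightarrow> (\<exists>i. occurs_at k y i)"

definition parity :: "nat^3 \<Rightarrow> ratfun \<Rightarrow> nat" where
  "parity k y = k $ (THE i. occurs_at k y i)"


section \<open>CMM matrices and triples\<close>

definition markov_const :: "nat^3 \<Rightarrow> ratfun" where
  "markov_const k =
     (x\<^sub>1^2 + x\<^sub>2^2 + x\<^sub>3^2 + of_nat (k $ 1) * x\<^sub>2 * x\<^sub>3 + of_nat (k $ 2) * x\<^sub>1 * x\<^sub>3
        + of_nat (k $ 3) * x\<^sub>1 * x\<^sub>2) / (x\<^sub>1 * x\<^sub>2 * x\<^sub>3)"

definition T_matrix :: "nat^3 \<Rightarrow> ratfun^2^2" where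
  "T_matrix k = vector [vector [- 1, 0], vector [markov_const k, - 1]]"

definition CMM_matrix :: "nat^3 \<Rightarrow> ratfun^2^2 \<Rightarrow> bool" where
  "CMM_matrix k X \<longleftrightarrow>
     (\<forall>i j. X $ i $ j \<in> laurent) \<and> det X = 1 \<and>
     cluster_variable k (X $ 1 $ 2) \<and> trace X = - of_nat (parity k (X $ 1 $ 2))"

definition CMM_triple :: "nat^3 \<Rightarrow> ratfun^2^2 \<Rightarrow> ratfun^2^2 \<Rightarrow> ratfun^2^2 \<Rightarrow> bool" where
  "CMM_triple k X Y Z \<longleftrightarrow>
     CMM_matrix k X \<and> CMM_matrix k Y \<and> CMM_matrix k Z \<and>
     X ** Y ** Z = T_matrix k \<and>
     vector [X $ 1 $ 2, Y $ 1 $ 2, Z $ 1 $ 2] \<in> nonlabeled_clusters k"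


section \<open>The Farey tree\<close>

text \<open>The pair \<open>(a, b)\<close> stands for the fraction \<open>a/b\<close>.\<close>

inductive farey_vertex :: "nat \<times> nat \<Rightarrow> nat \<times> nat \<Rightarrow> nat \<times> nat \<Rightarrow> bool" where
  root: "farey_vertex (0, 1) (1, 1) (1, 0)"
| left_child: "farey_vertex (a, b) (c, d) (e, f) \<Longrightarrow> farey_vertex (a, b) (a + c, b + d) (c, d)"
| right_child: "farey_vertex (a, b) (c, d) (e, f) \<Longrightarrow> farey_vertex (c, d) (c + e, d + f) (e, f)"


section \<open>Weighted fence posets\<close>

text \<open>A fence poset is given by the (distinct) list \<open>P\<close> of its elements in chronological order
  and a predicate \<open>gt\<close>: for consecutive \<open>x, y\<close> in \<open>P\<close>, \<open>gt x y\<close> says that \<open>x\<close> is greater than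
  \<open>y\<close>; otherwise \<open>x\<close> is less than \<open>y\<close>.\<close>

definition fence_gen :: "'a list \<Rightarrow> ('a \<Rightarrow> 'a \<Rightarrow> bool) \<Rightarrow> ('a \<times> 'a) set" where
  "fence_gen P gt =
     {(P ! Suc i, P ! i) | i. Suc i < length P \<and> gt (P ! i) (P ! Suc i)} \<union>
     {(P ! i, P ! Suc i) | i. Suc i < length P \<and> \<not> gt (P ! i) (P ! Suc i)}"

definition fence_less :: "'a list \<Rightarrow> ('a \<Rightarrow> 'a \<Rightarrow> bool) \<Rightarrow> ('a \<times> 'a) set" where
  "fence_less P gt = (fence_gen P gt)\<^sup>+"

definition order_ideals :: "'a list \<Rightarrow> ('a \<Rightarrow> 'a \<Rightarrow> bool) \<Rightarrow> 'a set set" where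
  "order_ideals P gt = {I. I \<subseteq> set P \<and> (\<forall>y \<in> I. \<forall>x. (x, y) \<in> fence_less P gt \<longrightarrow> x \<in> I)}"

text \<open>The weight polynomial restricted to the ideals that avoid the set \<open>A\<close>.\<close>

definition weight_poly ::
  "'a list \<Rightarrow> ('a \<Rightarrow> 'a \<Rightarrow> bool) \<Rightarrow> ('a \<Rightarrow> ratfun) \<Rightarrow> 'a set \<Rightarrow> ratfun" where
  "weight_poly P gt wt A = (\<Sum>I \<in> {I \<in> order_ideals P gt. I \<inter> A = {}}. \<Prod>x \<in> I. wt x)"


section \<open>The posets attached to positive fractions\<close>

text \<open>An arc is a label together with the two endpoints of a lattice segment.\<close>

type_synonym arc = "3 \<times> (real \<times> real) \<times> (real \<times> real)"

abbreviation label :: "arc \<Rightarrow> 3" where "label \<tau> \<equiv> fst \<tau>"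
abbreviation endpoints :: "arc \<Rightarrow> (real \<times> real) set" where
  "endpoints \<tau> \<equiv> {fst (snd \<tau>), snd (snd \<tau>)}"
abbreviation segment :: "arc \<Rightarrow> (real \<times> real) set" where
  "segment \<tau> \<equiv> closed_segment (fst (snd \<tau>)) (snd (snd \<tau>))"

definition arcs :: "arc set" where
  "arcs =
     {(3, (of_int m, of_int n), (of_int (m + 1), of_int n)) | m n. True} \<union>
     {(2, (of_int m, of_int n), (of_int m, of_int (n + 1))) | m n. True} \<union>
     {(1, (of_int m, of_int (n + 1)), (of_int (m + 1), of_int n)) | m n. True}"

text \<open>The line segment from \<open>(0, 0)\<close> to \<open>(q, p)\<close> without its endpoints.\<close>

definition gamma :: "nat \<Rightarrow> nat \<Rightarrow> (real \<times> real) set" where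
  "gamma p q = open_segment (0, 0) (of_nat q, of_nat p)"

definition crossed :: "nat \<Rightarrow> nat \<Rightarrow> arc set" where
  "crossed p q = {\<tau> \<in> arcs. gamma p q \<inter> segment \<tau> \<noteq> {}}"

definition crossing_point :: "nat \<Rightarrow> nat \<Rightarrow> arc \<Rightarrow> real \<times> real" where
  "crossing_point p q \<tau> = (THE z. z \<in> gamma p q \<inter> segment \<tau>)"

text \<open>As \<open>q > 0\<close>, the first coordinate increases along the line.\<close>

definition crossed_list :: "nat \<Rightarrow> nat \<Rightarrow> arc list" where
  "crossed_list p q = (THE ts. set ts = crossed p q \<and>
     sorted_wrt (\<lambda>\<tau> \<tau>'. fst (crossing_point p q \<tau>) < fst (crossing_point p q \<tau>')) ts)"

text \<open>The sign of the cross product with the direction \<open>(q, p)\<close> tells left from right.\<close>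

definition right_of :: "nat \<Rightarrow> nat \<Rightarrow> real \<times> real \<Rightarrow> bool" where
  "right_of p q z \<longleftrightarrow> of_nat q * snd z - of_nat p * fst z < 0"

definition left_of :: "nat \<Rightarrow> nat \<Rightarrow> real \<times> real \<Rightarrow> bool" where
  "left_of p q z \<longleftrightarrow> of_nat q * snd z - of_nat p * fst z > 0"

definition closer_to_right :: "nat \<Rightarrow> nat \<Rightarrow> arc \<Rightarrow> bool" where
  "closer_to_right p q \<tau> \<longleftrightarrow>
     dist (crossing_point p q \<tau>) (THE z. z \<in> endpoints \<tau> \<and> right_of p q z) <
     dist (crossing_point p q \<tau>) (THE z. z \<in> endpoints \<tau> \<and> left_of p q z)"

definition shared_endpoint :: "arc \<Rightarrow> arc \<Rightarrow> real \<times> real" where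
  "shared_endpoint \<tau> \<tau>' = (THE z. z \<in> endpoints \<tau> \<inter> endpoints \<tau>')"

text \<open>Elements of the poset are pairs \<open>(\<tau>, second)\<close>, where \<open>second\<close> tells whether this is the
  second element of the group of \<open>\<tau>\<close>.\<close>

definition P_list :: "nat^3 \<Rightarrow> nat \<Rightarrow> nat \<Rightarrow> (arc \<times> bool) list" where
  "P_list k p q = concat (map
     (\<lambda>\<tau>. if k $ label \<tau> = 0 then [(\<tau>, False)] else [(\<tau>, False), (\<tau>, True)])
     (crossed_list p q))"

definition P_gt :: "nat \<Rightarrow> nat \<Rightarrow> arc \<times> bool \<Rightarrow> arc \<times> bool \<Rightarrow> bool" where
  "P_gt p q x y \<longleftrightarrow>
     (if fst x = fst y then closer_to_right p q (fst x)
      else right_of p q (shared_endpoint (fst x) (fst y)))"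

definition P_wt :: "nat^3 \<Rightarrow> nat \<Rightarrow> nat \<Rightarrow> arc \<times> bool \<Rightarrow> ratfun" where
  "P_wt k p q x =
     (let \<tau> = fst x; second = snd x; a = label \<tau>;
          is_larger = (if second then \<not> closer_to_right p q \<tau> else closer_to_right p q \<tau>)
      in if k $ a = 0 then (xhat $ a)^2
         else if is_larger then xhat $ a / of_nat (k $ a)
         else of_nat (k $ a) * xhat $ a)"

definition WP :: "nat^3 \<Rightarrow> nat \<Rightarrow> nat \<Rightarrow> (arc \<times> bool) set \<Rightarrow> ratfun" where
  "WP k p q A = weight_poly (P_list k p q) (P_gt p q) (P_wt k p q) A"


section \<open>The matrices\<close>

definition g_vec :: "nat \<Rightarrow> nat \<Rightarrow> int^3" where
  "g_vec p q = vector [int q - int p - 1, 1 - int q, int p + 1]"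

definition g_circ :: "nat \<Rightarrow> nat \<Rightarrow> int^3" where
  "g_circ p q = vector [int q - int p, - int q, int p]"

definition M_01 :: "nat^3 \<Rightarrow> ratfun^2^2" where
  "M_01 k = vector
     [vector [x\<^sub>1 / x\<^sub>2, x\<^sub>3],
      vector [- (x\<^sub>1^2 / (x\<^sub>2^2 * x\<^sub>3)) * (1 + of_nat (k $ 3) * (x\<^sub>2 / x\<^sub>1) + x\<^sub>2^2 / x\<^sub>1^2),
              - (x\<^sub>1 / x\<^sub>2) - of_nat (k $ 3)]]"

definition M_10 :: "nat^3 \<Rightarrow> ratfun^2^2" where
  "M_10 k = vector [vector [- of_nat (k $ 2), x\<^sub>2], vector [- (1 / x\<^sub>2), 0]]"

definition M_pos :: "nat^3 \<Rightarrow> nat \<Rightarrow> nat \<Rightarrow> ratfun^2^2" where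
  "M_pos k p q =
     (let L = hd (P_list k p q); R = last (P_list k p q); g = g_vec p q; g' = g_circ p q
      in vector
        [vector [monomial g' * WP k p q {L}, monomial g * WP k p q {}],
         vector [- monomial (2 *s g' - g) * WP k p q {L, R}, - monomial g' * WP k p q {R}]])"

text \<open>\<open>M k p q\<close> is the matrix of the reduced fraction \<open>p/q\<close>; for coprime \<open>p, q\<close>, the value
  \<open>p = 0\<close> forces \<open>q = 1\<close> and vice versa.\<close>

definition M :: "nat^3 \<Rightarrow> nat \<Rightarrow> nat \<Rightarrow> ratfun^2^2" where
  "M k p q = (if p = 0 then M_01 k else if q = 0 then M_10 k else M_pos k p q)"

end

theory Submission
  imports Defs
begin

text \<open>Let \<open>N\<close> be the \<open>2 \<times> 2\<close> matrix that sums the weights of the ideals of \<open>\<P>\<^bsub>p/q\<^esub>\<close> according to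
  whether they contain the first and the last element. It is a product of transfer matrices along
  the crossed arcs, and \<open>M\<^bsub>p/q\<^esub> = c P N\<^sup>T Q\<close> with a scalar \<open>c\<close> multiplicative in \<open>(q, p)\<close> and constant
  \<open>P, Q\<close>. A half turn about the midpoint of the line shows that \<open>N\<^sup>T\<close> is the product in which only the
  group of the arc bisected by the line is reversed, so that \<open>M\<^sup>-\<^sup>1 = - c P N Q\<close> when \<open>det M = 1\<close>.
  For a Farey pair \<open>X, Z\<close> with mediant \<open>Y\<close>, pushing the line of \<open>Y\<close> onto the lines of \<open>X\<close> and \<open>Z\<close>
  crosses no lattice point and no arc midpoint except those bisected by the three lines; hence
  \<open>N\<^sub>Y\<^sup>T = N\<^sub>X C N\<^sub>Z\<close> with \<open>C = Q T P\<close>, that is \<open>M\<^sub>Y = M\<^sub>X\<^sup>-\<^sup>1 T M\<^sub>Z\<^sup>-\<^sup>1\<close>.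
  Thus \<open>X Y Z = T\<close> at each Farey vertex, and passing to a child replaces \<open>Z\<close> by \<open>Y Z Y\<^sup>-\<^sup>1\<close>
  or \<open>X\<close> by \<open>Y\<^sup>-\<^sup>1 X Y\<close>. This preserves traces and determinants, and its effect on the upper right
  entries is a mutation.\<close>

section \<open>Ideals of fence posets as matrix products\<close>

text \<open>Transfer matrix between neighbours: rows belong to the earlier element, columns to the
  later one, and index 2 means membership in the ideal. Its zero entry excludes that the larger
  element is in the ideal while the smaller is not.\<close>

definition link :: "bool \<Rightarrow> ratfun^2^2" where
  "link b = (if b then vector [vector [1, 1], vector [0, 1]] else vector [vector [1, 0], vector [1, 1]])"

definition diag2 :: "ratfun \<Rightarrow> ratfun^2^2" where
  "diag2 w = vector [vector [1, 0], vector [0, w]]"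

fun fence_matrix :: "('a \<Rightarrow> 'a \<Rightarrow> bool) \<Rightarrow> ('a \<Rightarrow> ratfun) \<Rightarrow> 'a list \<Rightarrow> ratfun^2^2" where
  "fence_matrix gt wt [] = mat 1"
| "fence_matrix gt wt [x] = diag2 (wt x)"
| "fence_matrix gt wt (x # y # ys) = diag2 (wt x) ** link (gt x y) ** fence_matrix gt wt (y # ys)"

definition closed_wrt :: "('a \<times> 'a) set \<Rightarrow> 'a set \<Rightarrow> bool" where
  "closed_wrt r I \<longleftrightarrow> (\<forall>y \<in> I. \<forall>x. (x, y) \<in> r \<longrightarrow> x \<in> I)"

text \<open>Closure propagates along chains, so ideals can be tested on neighbouring elements alone;
  this makes the transfer-matrix recursion possible.\<close>

lemma closed_wrt_trancl: "closed_wrt (r\<^sup>+) I \<longleftrightarrow> closed_wrt r I"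
proof
  assume *: "closed_wrt r I"
  have "x \<in> I" if "(x, y) \<in> r\<^sup>+" "y \<in> I" for x y
    using that by (induction rule: converse_trancl_induct) (use * in \<open>auto simp: closed_wrt_def\<close>)
  then show "closed_wrt (r\<^sup>+) I" by (auto simp: closed_wrt_def)
qed (auto simp: closed_wrt_def)

lemma order_ideals_altdef: "order_ideals P gt = {I. I \<subseteq> set P \<and> closed_wrt (fence_gen P gt) I}"
proof -
  have "order_ideals P gt = {I. I \<subseteq> set P \<and> closed_wrt ((fence_gen P gt)\<^sup>+) I}"
    by (simp add: order_ideals_def fence_less_def closed_wrt_def)
  then show ?thesis by (simp add: closed_wrt_trancl)
qed

lemma fence_gen_single: "fence_gen [x] gt = {}"
  by (auto simp: fence_gen_def)

lemma fence_gen_iff: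
  "(a, b) \<in> fence_gen P gt \<longleftrightarrow> (\<exists>i. Suc i < length P \<and>
     (if gt (P ! i) (P ! Suc i) then a = P ! Suc i \<and> b = P ! i else a = P ! i \<and> b = P ! Suc i))"
  unfolding fence_gen_def by auto

lemma fence_gen_Cons:
  "fence_gen (x # y # ys) gt = insert (if gt x y then (y, x) else (x, y)) (fence_gen (y # ys) gt)"
proof -
  have ex: "(\<exists>i. Suc i < length (x # y # ys) \<and> Q i) \<longleftrightarrow>
      Q 0 \<or> (\<exists>i. Suc i < length (y # ys) \<and> Q (Suc i))" for Q
    by (metis Suc_less_eq length_Cons not0_implies_Suc zero_less_Suc)
  have "(a, b) \<in> fence_gen (x # y # ys) gt \<longleftrightarrow>
      (a, b) = (if gt x y then (y, x) else (x, y)) \<or> (a, b) \<in> fence_gen (y # ys) gt" for a b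
    unfolding fence_gen_iff ex by (simp only: nth_Cons_0 nth_Cons_Suc) (simp split: if_split)
  then show ?thesis by (intro set_eqI) (simp only: split_paired_all insert_iff)
qed

lemma fence_gen_subset: "fence_gen P gt \<subseteq> set P \<times> set P"
  by (auto simp: fence_gen_def)

lemma closed_wrt_insert: "closed_wrt (insert (a, b) r) I \<longleftrightarrow> (b \<in> I \<longrightarrow> a \<in> I) \<and> closed_wrt r I"
  unfolding closed_wrt_def by blast

text \<open>The only generating relation that involves \<open>x\<close> links it to
  \<open>y\<close>; hence \<open>x\<close> interacts with the rest of an ideal only through the
  membership of \<open>y\<close>.\<close>

lemma order_ideals_Cons:
  assumes "x \<notin> set (y # ys)"
  shows "I \<in> order_ideals (x # y # ys) gt \<longleftrightarrow>
    I - {x} \<in> order_ideals (y # ys) gt \<and> (if gt x y then x \<in> I \<longrightarrow> y \<in> I else y \<in> I \<longrightarrow> x \<in> I)"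
proof -
  have "closed_wrt (fence_gen (y # ys) gt) (I - {x}) \<longleftrightarrow> closed_wrt (fence_gen (y # ys) gt) I"
    using fence_gen_subset[of "y # ys" gt] assms unfolding closed_wrt_def by blast
  moreover have "I - {x} \<subseteq> set (y # ys) \<longleftrightarrow> I \<subseteq> set (x # y # ys)"
    by auto
  ultimately show ?thesis
    unfolding order_ideals_altdef fence_gen_Cons mem_Collect_eq
    by (cases "gt x y") (simp_all only: if_True if_False closed_wrt_insert, blast+)
qed

lemma finite_order_ideals [simp]: "finite (order_ideals P gt)"
  by (rule finite_subset[of _ "Pow (set P)"]) (auto simp: order_ideals_altdef)

definition state :: "bool \<Rightarrow> 2" where "state b = (if b then 2 else 1)"

lemma diag2_link_nth:
  "(diag2 w ** link g ** N) $ state b $ j = (if b then w else 1) *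
     (\<Sum>b' \<in> (if g then if b then {True} else UNIV else if b then UNIV else {False}). N $ state b' $ j)"
proof -
  have "(diag2 w ** link g ** N) $ i $ j = (if i = 1 then 1 else w) *
      ((if g \<and> i = 2 then 0 else N $ 1 $ j) + (if \<not> g \<and> i = 1 then 0 else N $ 2 $ j))" for i
    using exhaust_2[of i] by (cases g) (auto simp: matrix_matrix_mult_def sum_2 diag2_def link_def distrib_left)
  then show ?thesis by (cases b; cases g) (auto simp: UNIV_bool state_def)
qed

text \<open>The row index records the first element of the poset, the column index the last one.\<close>

lemma fence_matrix_nth:
  assumes "distinct P" "P \<noteq> []"
  shows "fence_matrix gt wt P $ state b $ state e =
    (\<Sum>I \<in> {I \<in> order_ideals P gt. (hd P \<in> I) = b \<and> (last P \<in> I) = e}. \<Prod>x \<in> I. wt x)"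
  using assms
proof (induction gt wt P arbitrary: b rule: fence_matrix.induct)
  case (2 gt wt x)
  have "{I \<in> order_ideals [x] gt. (hd [x] \<in> I) = b \<and> (last [x] \<in> I) = e} =
        (if b = e then if b then {{x}} else {{}} else {})"
    by (auto simp: order_ideals_altdef fence_gen_single closed_wrt_def)
  then show ?case by (simp add: diag2_def state_def)
next
  case (3 gt wt x y ys)
  let ?T = "\<lambda>b'. {J \<in> order_ideals (y # ys) gt. (hd (y # ys) \<in> J) = b' \<and> (last (y # ys) \<in> J) = e}"
  let ?S = "{I \<in> order_ideals (x # y # ys) gt. (hd (x # y # ys) \<in> I) = b \<and> (last (x # y # ys) \<in> I) = e}"
  let ?B = "{b'. if gt x y then b \<longrightarrow> b' else b' \<longrightarrow> b}"
  let ?ins = "\<lambda>J. if b then insert x J else J"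
  have x: "x \<notin> set (y # ys)" "last (y # ys) \<noteq> x" "x \<noteq> y" using 3 last_in_set[of "y # ys"] by auto
  have xJ: "x \<notin> J" if "J \<in> order_ideals (y # ys) gt" for J
    using x that by (auto simp: order_ideals_altdef)
  \<comment> \<open>An ideal arises from an ideal of the tail whose membership of \<open>y\<close>
    is compatible with \<open>b\<close>, by adding \<open>x\<close> exactly if \<open>b\<close>
    holds.\<close>
  have S: "?S = ?ins ` (\<Union>b' \<in> ?B. ?T b')" (is "_ = ?R")
  proof (intro equalityI subsetI)
    fix I assume "I \<in> ?S"
    then have I: "I \<in> order_ideals (x # y # ys) gt" "(x \<in> I) = b" "(last (y # ys) \<in> I) = e"
      by simp_all
    note I' = I(1)[unfolded order_ideals_Cons[OF x(1)]]
    have "I - {x} \<in> ?T (y \<in> I)" using I' I(3) x by simp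
    moreover have "(y \<in> I) \<in> ?B" using I' I(2) by (simp split: if_splits)
    moreover have "I = ?ins (I - {x})" using I(2) by auto
    ultimately show "I \<in> ?R" by blast
  next
    fix I assume "I \<in> ?R"
    then obtain J b' where b': "b' \<in> ?B" and J: "J \<in> ?T b'" and I: "I = ?ins J" by blast
    have "x \<notin> J" using J xJ by blast
    then have "I - {x} = J" "(x \<in> I) = b" "(y \<in> I) = b'" "(last (y # ys) \<in> I) = e"
      using I J x by auto
    then show "I \<in> ?S"
      using b' J order_ideals_Cons[OF x(1), of I gt] by (simp split: if_splits)
  qed
  have fin: "finite J" if "J \<in> order_ideals (y # ys) gt" for J
    using that by (auto simp: order_ideals_altdef intro: finite_subset)
  have "(\<Sum>I \<in> ?S. \<Prod>x \<in> I. wt x) = (\<Sum>J \<in> (\<Union>b' \<in> ?B. ?T b'). \<Prod>x \<in> ?ins J. wt x)"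
    unfolding S
  proof (rule sum.reindex_cong[OF _ refl refl])
    show "inj_on ?ins (\<Union>b' \<in> ?B. ?T b')"
      by (rule inj_on_inverseI[of _ "\<lambda>I. I - {x}"]) (use xJ in auto)
  qed
  also have "\<dots> = (\<Sum>J \<in> (\<Union>b' \<in> ?B. ?T b'). (if b then wt x else 1) * (\<Prod>x \<in> J. wt x))"
    by (rule sum.cong[OF refl]) (use xJ fin in auto)
  also have "\<dots> = (\<Sum>b' \<in> ?B. \<Sum>J \<in> ?T b'. (if b then wt x else 1) * (\<Prod>x \<in> J. wt x))"
    by (rule sum.UNION_disjoint) auto
  also have "\<dots> = (if b then wt x else 1) * (\<Sum>b' \<in> ?B. \<Sum>J \<in> ?T b'. \<Prod>x \<in> J. wt x)"
    by (simp add: sum_distrib_left)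
  also have "\<dots> = (if b then wt x else 1) * (\<Sum>b' \<in> ?B. fence_matrix gt wt (y # ys) $ state b' $ state e)"
    using 3 by simp
  also have "?B = (if gt x y then if b then {True} else UNIV else if b then UNIV else {False})"
    by auto
  finally have sum: "(\<Sum>I \<in> ?S. \<Prod>x \<in> I. wt x) = (if b then wt x else 1) *
      (\<Sum>b' \<in> (if gt x y then if b then {True} else UNIV else if b then UNIV else {False}).
        fence_matrix gt wt (y # ys) $ state b' $ state e)" .
  show ?case unfolding fence_matrix.simps diag2_link_nth sum ..
qed simp

text \<open>Whether an ideal avoids one of these sets depends only on its two end memberships, so
  each polynomial collects some of the four matrix entries.\<close>

lemma weight_poly_fence_matrix:
  fixes gt :: "'a \<Rightarrow> 'a \<Rightarrow> bool" and wt :: "'a \<Rightarrow> ratfun"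
  assumes "distinct P" "P \<noteq> []"
  defines "N \<equiv> fence_matrix gt wt P"
  shows "weight_poly P gt wt {} = N $ 1 $ 1 + N $ 1 $ 2 + N $ 2 $ 1 + N $ 2 $ 2"
    and "weight_poly P gt wt {hd P} = N $ 1 $ 1 + N $ 1 $ 2"
    and "weight_poly P gt wt {last P} = N $ 1 $ 1 + N $ 2 $ 1"
    and "weight_poly P gt wt {hd P, last P} = N $ 1 $ 1"
proof -
  have *: "weight_poly P gt wt A = (\<Sum>b \<in> UNIV. \<Sum>e \<in> UNIV. if R b e then N $ state b $ state e else 0)"
    if R: "\<And>I. I \<inter> A = {} \<longleftrightarrow> R (hd P \<in> I) (last P \<in> I)" for A R
  proof -
    have "(\<Sum>b \<in> UNIV. \<Sum>e \<in> UNIV. if R b e then N $ state b $ state e else 0) =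
        (\<Sum>b \<in> UNIV. \<Sum>e \<in> UNIV. \<Sum>I \<in> order_ideals P gt.
          if R b e \<and> (hd P \<in> I) = b \<and> (last P \<in> I) = e then prod wt I else 0)"
      unfolding N_def fence_matrix_nth[OF assms(1,2)]
      by (intro sum.cong refl) (simp add: sum.inter_filter)
    also have "\<dots> = (\<Sum>I \<in> order_ideals P gt. \<Sum>b \<in> UNIV. \<Sum>e \<in> UNIV.
          if R b e \<and> (hd P \<in> I) = b \<and> (last P \<in> I) = e then prod wt I else 0)"
      by (simp add: sum.swap[of _ "order_ideals P gt"])
    also have "\<dots> = (\<Sum>I \<in> order_ideals P gt. if I \<inter> A = {} then prod wt I else 0)"
    proof (intro sum.cong refl)
      fix I
      show "(\<Sum>b \<in> UNIV. \<Sum>e \<in> UNIV. if R b e \<and> (hd P \<in> I) = b \<and> (last P \<in> I) = e then prod wt I else 0) =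
          (if I \<inter> A = {} then prod wt I else 0)"
        unfolding R by (cases "hd P \<in> I"; cases "last P \<in> I") (simp_all add: UNIV_bool)
    qed
    finally show ?thesis by (simp add: weight_poly_def sum.inter_filter)
  qed
  show "weight_poly P gt wt {} = N $ 1 $ 1 + N $ 1 $ 2 + N $ 2 $ 1 + N $ 2 $ 2"
    by (subst *[of _ "\<lambda>_ _. True"]) (simp_all add: UNIV_bool state_def)
  show "weight_poly P gt wt {hd P} = N $ 1 $ 1 + N $ 1 $ 2"
    by (subst *[of _ "\<lambda>b _. \<not> b"]) (simp_all add: UNIV_bool state_def)
  show "weight_poly P gt wt {last P} = N $ 1 $ 1 + N $ 2 $ 1"
    by (subst *[of _ "\<lambda>_ e. \<not> e"]) (simp_all add: UNIV_bool state_def)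
  show "weight_poly P gt wt {hd P, last P} = N $ 1 $ 1"
    by (subst *[of _ "\<lambda>b e. \<not> b \<and> \<not> e"]) (simp_all add: UNIV_bool state_def)
qed

section \<open>Parity of cluster variables\<close>

text \<open>Positivity of a polynomial is positivity of its leading coefficient. The indeterminate
  therefore exceeds all constants, and positive polynomials are compared by degree first.\<close>

lemma degree_lead_coeff_mono:
  fixes p q :: "'a::linordered_idom poly"
  assumes "0 < p" "p \<le> q"
  shows "degree p \<le> degree q" and "degree p = degree q \<Longrightarrow> lead_coeff p \<le> lead_coeff q"
proof -
  have p: "lead_coeff p > 0" using assms(1) by (simp add: less_poly_def pos_poly_def)
  have "q > 0" using assms by simp
  then have q: "lead_coeff q > 0" by (simp add: less_poly_def pos_poly_def)
  show deg: "degree p \<le> degree q"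
  proof (rule ccontr)
    assume "\<not> degree p \<le> degree q"
    then have "coeff q (degree p) = 0" "degree (q - p) = degree p"
      using degree_add_eq_right[of q "- p"] by (simp_all add: coeff_eq_0)
    then have "lead_coeff (q - p) < 0" using p by simp
    then show False using assms(2) \<open>\<not> degree p \<le> degree q\<close>
      by (auto simp: less_eq_poly_def pos_poly_def)
  qed
  show "lead_coeff p \<le> lead_coeff q" if eq: "degree p = degree q"
  proof (rule ccontr)
    assume n: "\<not> lead_coeff p \<le> lead_coeff q"
    have neg: "coeff (q - p) (degree p) < 0" using n eq by simp
    then have "degree (q - p) = degree p"
      using eq le_degree[OF less_imp_neq[OF neg]] by (intro antisym degree_diff_le) simp_all
    then have "lead_coeff (q - p) < 0" using neg by simp
    then show False using assms(2) n by (auto simp: less_eq_poly_def pos_poly_def)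
  qed
qed

lemma degree_of_nat_mult:
  fixes p :: "'a::linordered_idom poly"
  assumes "n > 0"
  shows "degree (of_nat n * p) = degree p" "lead_coeff (of_nat n * p) = of_nat n * lead_coeff p"
proof -
  have "of_nat n * p = smult (of_nat n) p" by (simp add: of_nat_poly)
  then show "degree (of_nat n * p) = degree p" "lead_coeff (of_nat n * p) = of_nat n * lead_coeff p"
    using assms by simp_all
qed

text \<open>Natural multiples do not change degrees, so mutual bounds force equal degrees. The
  leading coefficients then satisfy the same bounds, and the argument repeats one level further
  in.\<close>

lemma degrees_eqI:
  fixes p q :: "'a::linordered_idom poly poly"
  assumes "0 < p" "0 < q" "p \<le> of_nat n * q" "q \<le> of_nat n * p"
  shows "degree p = degree q" "degree (lead_coeff p) = degree (lead_coeff q)"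
proof -
  have n: "n > 0" using assms by (cases n) auto
  show eq: "degree p = degree q"
    using degree_lead_coeff_mono(1)[OF assms(1,3)] degree_lead_coeff_mono(1)[OF assms(2,4)]
    by (simp add: degree_of_nat_mult[OF n])
  have "lead_coeff p \<le> of_nat n * lead_coeff q"
    using degree_lead_coeff_mono(2)[OF assms(1,3)] eq degree_of_nat_mult[OF n] by metis
  moreover have "lead_coeff q \<le> of_nat n * lead_coeff p"
    using degree_lead_coeff_mono(2)[OF assms(2,4)] eq degree_of_nat_mult[OF n] by metis
  moreover have "0 < lead_coeff p" "0 < lead_coeff q"
    using assms(1,2) by (simp_all add: less_poly_def pos_poly_def)
  ultimately show "degree (lead_coeff p) = degree (lead_coeff q)"
    using degree_lead_coeff_mono(1)[of "lead_coeff p"] degree_lead_coeff_mono(1)[of "lead_coeff q"]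
    by (metis antisym degree_of_nat_mult(1)[OF n])
qed

text \<open>In the ordered field of rational functions, \<open>y / x\<close> is Archimedean equivalent to a square.
  The exchange relations preserve this for the variables in one position, since \<open>b\<^sup>2 + k b d + d\<^sup>2\<close> is
  equivalent to \<open>max b d ^ 2\<close>, and \<open>x\<^sub>1\<close>, \<open>x\<^sub>2\<close>, \<open>x\<^sub>3\<close> lie in different classes; so a cluster variable
  determines its position.\<close>

definition square_class :: "ratfun \<Rightarrow> ratfun \<Rightarrow> bool" where
  "square_class x y \<longleftrightarrow> y > 0 \<and> (\<exists>z > 0. \<exists>n. z^2 * x \<le> of_nat n * y \<and> y \<le> of_nat n * (z^2 * x))"

lemma square_class_refl: "x > 0 \<Longrightarrow> square_class x x"
  unfolding square_class_def by (auto intro!: exI[of _ 1])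

lemma square_class_exchange:
  assumes "x > 0" "square_class x a" "b > 0" "d > 0"
  shows "square_class x ((b^2 + of_nat k * b * d + d^2) / a)"
  using assms(3,4)
proof (induction b d rule: linorder_wlog)
  case (sym b d)
  then show ?case by (simp add: algebra_simps)
next
  case (le d b)
  obtain z n where z: "a > 0" "z > 0" "z^2 * x \<le> of_nat n * a" "a \<le> of_nat n * (z^2 * x)"
    using assms(2) unfolding square_class_def by blast
  have n: "n > 0" using z by (cases n) auto
  let ?s = "b^2 + of_nat k * b * d + d^2" and ?w = "z^2 * x"
  have w: "?w > 0" using z assms by simp
  have "b^2 \<le> ?s" using le by simp
  moreover have "?s \<le> of_nat (k + 2) * b^2"
  proof -
    have "d^2 \<le> b^2" using le by (simp add: power_mono)
    moreover have "of_nat k * b * d \<le> of_nat k * b * b" using le by (intro mult_left_mono) auto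
    ultimately show ?thesis by (simp add: algebra_simps power2_eq_square)
  qed
  ultimately have s: "b^2 \<le> ?s" "?s \<le> of_nat (k + 2) * b^2" "?s > 0"
    using le by (auto intro!: add_pos_nonneg)
  \<comment> \<open>Up to bounded factors the numerator is \<open>b^2\<close> and \<open>a\<close>
    is \<open>z^2 * x\<close>. Their quotient is a square times \<open>x\<close>, and
    \<open>b / (z * x)\<close> is the new root.\<close>
  have w2: "(b / (z * x))^2 * x = b^2 / ?w" using assms(1) by (simp add: power2_eq_square)
  have "b^2 / ?w \<le> of_nat ((k + 2) * n) * (?s / a)"
  proof -
    have "b^2 / ?w \<le> ?s / ?w" using s(1) w by (simp add: divide_right_mono)
    also have "1 / ?w \<le> of_nat n / a" using z w by (simp add: field_simps)
    then have "?s / ?w \<le> ?s * (of_nat n / a)" using s(3)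
      by (metis divide_inverse mult_left_mono less_imp_le mult_1)
    also have "\<dots> = of_nat n * (?s / a)" by simp
    also have "\<dots> \<le> of_nat ((k + 2) * n) * (?s / a)"
      using s(3) z(1) by (intro mult_right_mono) (auto simp: of_nat_le_iff simp del: of_nat_mult of_nat_add)
    finally show ?thesis .
  qed
  moreover have "?s / a \<le> of_nat ((k + 2) * n) * (b^2 / ?w)"
  proof -
    have "1 / a \<le> of_nat n / ?w" using z w by (simp add: field_simps)
    then have "?s * (1 / a) \<le> (of_nat (k + 2) * b^2) * (of_nat n / ?w)"
      using s z(1) by (intro mult_mono) auto
    then show ?thesis unfolding of_nat_mult by (simp add: mult_ac del: of_nat_add)
  qed
  ultimately have "square_class x (?s / a)"
    unfolding square_class_def w2[symmetric]
    using s(3) z assms(1) le by (intro conjI exI[of _ "b / (z * x)"] exI[of _ "(k + 2) * n"]) auto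
  moreover have "d^2 + of_nat k * d * b + b^2 = ?s" by (simp add: algebra_simps)
  ultimately show ?case by (simp only:)
qed

abbreviation poly3 :: "int poly poly poly \<Rightarrow> ratfun" where "poly3 p \<equiv> Fract p 1"

text \<open>Eliminating \<open>y\<close> makes \<open>(z / w)^2 * p\<close> equivalent to
  \<open>q\<close>. With \<open>z / w = f / g\<close> and denominators cleared,
  \<open>f^2 * p\<close> and \<open>g^2 * q\<close> have equal degrees; the squares contribute even
  amounts, so the parities agree.\<close>

lemma square_class_degrees:
  fixes p q :: "int poly poly poly"
  assumes "square_class (poly3 p) y" "square_class (poly3 q) y" "p > 0" "q > 0"
  shows "even (degree p + degree q)" "even (degree (lead_coeff p) + degree (lead_coeff q))"
proof -
  obtain z n where z: "y > 0" "z > 0" "z^2 * poly3 p \<le> of_nat n * y" "y \<le> of_nat n * (z^2 * poly3 p)"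
    using assms(1) unfolding square_class_def by blast
  obtain w m where w: "w > 0" "w^2 * poly3 q \<le> of_nat m * y" "y \<le> of_nat m * (w^2 * poly3 q)"
    using assms(2) unfolding square_class_def by blast
  obtain f g where fg: "z / w = Fract f g" "g > 0"
    by (metis fract_induct_pos[of "\<lambda>r. \<exists>f g. r = Fract f g \<and> g > 0" "z / w"])
  have f: "f > 0" using z(2) w(1) fg by (metis divide_pos_pos zero_less_Fract_iff)
  have 1: "z^2 * poly3 p \<le> of_nat (n * m) * (w^2 * poly3 q)"
  proof -
    have "z^2 * poly3 p \<le> of_nat n * y" by fact
    also have "\<dots> \<le> of_nat n * (of_nat m * (w^2 * poly3 q))" using w by (intro mult_left_mono) auto
    finally show ?thesis by (simp add: algebra_simps)
  qed
  have 2: "w^2 * poly3 q \<le> of_nat (n * m) * (z^2 * poly3 p)"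
  proof -
    have "w^2 * poly3 q \<le> of_nat m * y" by fact
    also have "\<dots> \<le> of_nat m * (of_nat n * (z^2 * poly3 p))" using z by (intro mult_left_mono) auto
    finally show ?thesis by (simp add: algebra_simps)
  qed
  have F: "(z / w)^2 = Fract (f^2) (g^2)" by (simp add: fg power2_eq_square)
  have zw: "z^2 = (z / w)^2 * w^2" using w(1) by (simp add: power_divide)
  have "(z / w)^2 * poly3 p \<le> of_nat (n * m) * poly3 q"
    using 1 w(1) unfolding zw by (simp add: algebra_simps)
  then have "Fract (f^2 * p) (g^2) \<le> Fract (of_nat (n * m) * q) 1"
    unfolding F of_nat_fract by simp
  then have "(f^2 * p) * g^2 \<le> (of_nat (n * m) * (g^2 * q)) * g^2"
    using fg(2) by (subst (asm) le_fract) (auto simp: mult_ac power2_eq_square)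
  then have 3: "f^2 * p \<le> of_nat (n * m) * (g^2 * q)"
    by (rule mult_right_le_imp_le) (use fg(2) in simp)
  have "poly3 q \<le> of_nat (n * m) * ((z / w)^2 * poly3 p)"
    using 2 w(1) unfolding zw by (simp add: algebra_simps)
  then have "Fract q 1 \<le> Fract (of_nat (n * m) * (f^2 * p)) (g^2)"
    unfolding F of_nat_fract by simp
  then have "(g^2 * q) * g^2 \<le> (of_nat (n * m) * (f^2 * p)) * g^2"
    using fg(2) by (subst (asm) le_fract) (auto simp: mult_ac power2_eq_square)
  then have 4: "g^2 * q \<le> of_nat (n * m) * (f^2 * p)"
    by (rule mult_right_le_imp_le) (use fg(2) in simp)
  have pos: "f^2 * p > 0" "g^2 * q > 0" using f fg(2) assms(3,4) by auto
  have nz: "f \<noteq> 0" "g \<noteq> 0" "p \<noteq> 0" "q \<noteq> 0" using f fg(2) assms(3,4) by auto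
  note e = degrees_eqI[OF pos 3 4]
  have "2 * degree f + degree p = 2 * degree g + degree q"
    using e(1) nz by (simp add: degree_mult_eq degree_power_eq)
  then show "even (degree p + degree q)" by presburger
  have "2 * degree (lead_coeff f) + degree (lead_coeff p) = 2 * degree (lead_coeff g) + degree (lead_coeff q)"
    using e(2)[unfolded lead_coeff_mult lead_coeff_power] nz
    by (simp add: degree_mult_eq degree_power_eq)
  then show "even (degree (lead_coeff p) + degree (lead_coeff q))" by presburger
qed

definition initial_cluster :: "ratfun^3" where "initial_cluster = vector [x\<^sub>1, x\<^sub>2, x\<^sub>3]"

lemma pos_pCons [simp]: "p > 0 \<Longrightarrow> pCons 0 p > (0 :: 'a::linordered_idom poly)"
  by (simp add: less_poly_def pos_poly_pCons)

lemma pos_const [simp]: "c > 0 \<Longrightarrow> [:c:] > (0 :: 'a::linordered_idom poly)"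
  by (simp add: less_poly_def pos_poly_pCons)

lemma x_pos [simp]: "x\<^sub>1 > 0" "x\<^sub>2 > 0" "x\<^sub>3 > 0"
  by (simp_all add: x\<^sub>1_def x\<^sub>2_def x\<^sub>3_def zero_less_Fract_iff)

lemma initial_cluster_pos: "initial_cluster $ i > 0"
  using exhaust_3[of i] by (auto simp: initial_cluster_def)

text \<open>The parities of the degree and of the degree of the leading coefficient are (0,0), (0,1)
  and (1,0) for \<open>x\<^sub>1\<close>, \<open>x\<^sub>2\<close> and \<open>x\<^sub>3\<close>,
  which are pairwise distinct.\<close>

lemma square_class_unique:
  assumes "square_class (initial_cluster $ i) y" "square_class (initial_cluster $ j) y"
  shows "i = j"
proof -
  define P :: "3 \<Rightarrow> int poly poly poly" where
    "P i = (if i = 1 then [:[:[:0, 1:]:]:] else if i = 2 then [:[:0, 1:]:] else [:0, 1:])" for i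
  have P: "initial_cluster $ i = poly3 (P i)" "P i > 0" for i
    using exhaust_3[of i] by (auto simp: P_def initial_cluster_def x\<^sub>1_def x\<^sub>2_def x\<^sub>3_def)
  show ?thesis
    using square_class_degrees[OF assms[unfolded P] P(2) P(2)] exhaust_3[of i] exhaust_3[of j]
    by (auto simp: P_def)
qed

lemma labeled_cluster_square_class:
  "c \<in> labeled_clusters k \<Longrightarrow> square_class (initial_cluster $ i) (c $ i)"
proof (induction arbitrary: i rule: labeled_clusters.induct)
  case initial
  then show ?case
    using square_class_refl[OF initial_cluster_pos] by (simp add: initial_cluster_def)
next
  case (mut1 c)
  have "c $ i > 0" for i using mut1.IH[of i] by (simp add: square_class_def)
  then show ?case using mut1.IH exhaust_3[of i]
      square_class_exchange[OF initial_cluster_pos mut1.IH, of "c $ 2" "c $ 3" 1 "k $ 1"]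
    by (auto simp: mu1_def Let_def)
next
  case (mut2 c)
  have "c $ i > 0" for i using mut2.IH[of i] by (simp add: square_class_def)
  then show ?case using mut2.IH exhaust_3[of i]
      square_class_exchange[OF initial_cluster_pos mut2.IH, of "c $ 1" "c $ 3" 2 "k $ 2"]
    by (auto simp: mu2_def Let_def)
next
  case (mut3 c)
  have "c $ i > 0" for i using mut3.IH[of i] by (simp add: square_class_def)
  then show ?case using mut3.IH exhaust_3[of i]
      square_class_exchange[OF initial_cluster_pos mut3.IH, of "c $ 1" "c $ 2" 3 "k $ 3"]
    by (auto simp: mu3_def Let_def)
qed

lemma labeled_cluster_pos: "c \<in> labeled_clusters k \<Longrightarrow> c $ i > 0"
  using labeled_cluster_square_class by (auto simp: square_class_def)

text \<open>The square class of a cluster variable pins down its position, so the definite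
  description in \<open>parity\<close> denotes it.\<close>

lemma parity_labeled_cluster:
  assumes "c \<in> labeled_clusters k"
  shows "parity k (c $ i) = k $ i"
proof -
  have "(THE j. occurs_at k (c $ i) j) = i"
  proof (rule the_equality)
    show "occurs_at k (c $ i) i" using assms by (auto simp: occurs_at_def)
    show "j = i" if "occurs_at k (c $ i) j" for j
      using that assms labeled_cluster_square_class square_class_unique
      unfolding occurs_at_def by metis
  qed
  then show ?thesis by (simp add: parity_def)
qed

lemma labeled_cluster_mutation:
  assumes "c \<in> labeled_clusters k" "i \<noteq> j" "i \<noteq> l" "j \<noteq> l"
  obtains c' where "c' \<in> labeled_clusters k" "c' $ j = c $ j" "c' $ l = c $ l"
    "c' $ i = ((c $ j)^2 + of_nat (k $ i) * c $ j * c $ l + (c $ l)^2) / c $ i"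
proof -
  consider "i = 1" | "i = 2" | "i = 3" using exhaust_3 by blast
  then show thesis
  proof cases
    case 1
    then show thesis using assms exhaust_3[of j] exhaust_3[of l]
      by (intro that[of "mu1 k c"] labeled_clusters.intros) (auto simp: mu1_def Let_def algebra_simps)
  next
    case 2
    then show thesis using assms exhaust_3[of j] exhaust_3[of l]
      by (intro that[of "mu2 k c"] labeled_clusters.intros) (auto simp: mu2_def Let_def algebra_simps)
  next
    case 3
    then show thesis using assms exhaust_3[of j] exhaust_3[of l]
      by (intro that[of "mu3 k c"] labeled_clusters.intros) (auto simp: mu3_def Let_def algebra_simps)
  qed
qed

section \<open>Walks along a line\<close>

type_synonym mat2 = "ratfun^2^2"

text \<open>Transfer matrix of the group of one arc, where \<open>e\<close> says that the first
  element is the larger: \<open>n * h\<close> is the weight of the smaller element and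
  \<open>h^2\<close> the product of both. For \<open>n = 0\<close> it is the matrix of the single
  element of weight \<open>h^2\<close>.\<close>

definition group_matrix :: "nat \<Rightarrow> ratfun \<Rightarrow> bool \<Rightarrow> mat2" where
  "group_matrix n h e =
     (if e then vector [vector [1, of_nat n * h], vector [0, h^2]]
      else vector [vector [1, 0], vector [of_nat n * h, h^2]])"

text \<open>The product of \<open>D c\<close>, \<open>S c\<close>, \<open>D (c + 1)\<close>, ...,
  \<open>D (c + l)\<close>: there are \<open>l\<close> factors \<open>S\<close> but
  \<open>l + 1\<close> factors \<open>D\<close>.\<close>

fun walk :: "(nat \<Rightarrow> mat2) \<Rightarrow> (nat \<Rightarrow> mat2) \<Rightarrow> nat \<Rightarrow> nat \<Rightarrow> mat2" where
  "walk D S c 0 = D c"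
| "walk D S c (Suc l) = D c ** S c ** walk D S (Suc c) l"

lemma walk_append:
  "walk D S c (Suc (l + l')) = walk D S c l ** S (c + l) ** walk D S (Suc (c + l)) l'"
  by (induction l arbitrary: c) (simp_all add: matrix_mul_assoc)

lemma walk_cong:
  assumes "\<And>i. i \<le> l \<Longrightarrow> D (c + i) = D' (c' + i)" "\<And>i. i < l \<Longrightarrow> S (c + i) = S' (c' + i)"
  shows "walk D S c l = walk D' S' c' l"
  using assms
proof (induction l arbitrary: c c')
  case 0
  then show ?case by (metis add.right_neutral le_refl walk.simps(1))
next
  case (Suc l)
  have "walk D S (Suc c) l = walk D' S' (Suc c') l"
    using Suc.prems[of "Suc _"] by (intro Suc.IH) auto
  then show ?case using Suc.prems(1)[of 0] Suc.prems(2)[of 0] by simp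
qed

lemma walk_transpose:
  assumes "\<And>i. i \<le> l \<Longrightarrow> D' (c' + i) = transpose (D (c + (l - i)))"
    and "\<And>i. i < l \<Longrightarrow> S' (c' + i) = transpose (S (c + (l - Suc i)))"
  shows "walk D' S' c' l = transpose (walk D S c l)"
  using assms
proof (induction l arbitrary: c')
  case (Suc l)
  have "walk D' S' (Suc c') l = transpose (walk D S c l)"
  proof (rule Suc.IH)
    fix i assume "i \<le> l"
    then show "D' (Suc c' + i) = transpose (D (c + (l - i)))" using Suc.prems(1)[of "Suc i"] by simp
  next
    fix i assume "i < l"
    then show "S' (Suc c' + i) = transpose (S (c + (l - Suc i)))" using Suc.prems(2)[of "Suc i"] by simp
  qed
  then show ?case
    using Suc.prems(1)[of 0] Suc.prems(2)[of 0] walk_append[of D S c l 0]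
    by (simp add: matrix_transpose_mul matrix_mul_assoc)
qed (use assms(1)[of 0] in simp)

section \<open>Antidiagonals and the lattice points on either side of a line\<close>

definition side :: "nat \<Rightarrow> nat \<Rightarrow> int \<Rightarrow> int \<Rightarrow> int" where
  "side p q x y = int q * y - int p * x"

text \<open>The line through the origin in direction \<open>(q, p)\<close> meets
  \<open>x + y = c\<close> at abscissa \<open>q c / (p + q)\<close>. The floor of this is the
  abscissa of the upper left endpoint of the diagonal arc crossed there.\<close>

definition level :: "nat \<Rightarrow> nat \<Rightarrow> nat \<Rightarrow> int" where
  "level p q c = (int q * int c) div int (p + q)"

text \<open>Coprimality keeps \<open>p + q\<close> from dividing \<open>q * c\<close>, so the line
  misses the lattice points of this antidiagonal and both inequalities are strict.\<close>

lemma level_bounds: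
  assumes "coprime p q" "0 < c" "c < p + q"
  defines "m \<equiv> level p q c"
  shows "side p q m (int c - m) > 0" "side p q (m + 1) (int c - m - 1) < 0"
proof -
  define n where "n = int (p + q)"
  have n: "n > 0" using assms by (simp add: n_def)
  have "\<not> n dvd int q * int c"
  proof
    assume "n dvd int q * int c"
    then have "p + q dvd q * c" unfolding n_def by (metis int_dvd_int_iff of_nat_mult)
    moreover have "coprime (p + q) q" using assms(1) by (simp add: coprime_iff_gcd_eq_1)
    ultimately have "p + q dvd c" using coprime_dvd_mult_right_iff by blast
    then show False using assms by (auto dest: dvd_imp_le)
  qed
  then have "int q * int c mod n > 0" using n
    by (metis dvd_eq_mod_eq_0 linorder_neqE_linordered_idom pos_mod_sign not_less)
  moreover have "int q * int c mod n < n" using n by simp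
  moreover have "int q * int c = n * m + int q * int c mod n"
    by (simp add: m_def level_def n_def)
  moreover have "side p q m (int c - m) = int q * int c - n * m"
    "side p q (m + 1) (int c - m - 1) = int q * int c - n * m - n"
    by (simp_all add: side_def n_def algebra_simps)
  ultimately show "side p q m (int c - m) > 0" "side p q (m + 1) (int c - m - 1) < 0" by linarith+
qed

lemma level_eqI:
  assumes "side p q m (int c - m) \<ge> 0" "side p q (m + 1) (int c - m - 1) < 0"
  shows "level p q c = m"
  unfolding level_def using assms
  by (intro int_div_pos_eq[where r = "side p q m (int c - m)"]) (auto simp: side_def algebra_simps)

text \<open>From one antidiagonal to the next the abscissa grows by \<open>q / (p + q)\<close>,
  which is at most 1. If the floor stays, a horizontal arc lies in between; if it rises, a vertical
  one.\<close>

lemma level_Suc_cases: "p + q > 0 \<Longrightarrow> level p q (Suc c) = level p q c \<or> level p q (Suc c) = level p q c + 1"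
proof -
  assume "p + q > 0"
  define n where "n = int (p + q)"
  define a where "a = int q * int c"
  have n: "n > 0" "0 \<le> int q" "int q \<le> n" using \<open>p + q > 0\<close> by (auto simp: n_def)
  have "(a + int q) div n \<ge> a div n" by (rule zdiv_mono1) (use n in auto)
  moreover have "(a + int q) div n \<le> (a + n) div n" by (rule zdiv_mono1) (use n in auto)
  moreover have "(a + n) div n = a div n + 1" using n by simp
  ultimately show ?thesis unfolding level_def n_def[symmetric] a_def by (simp add: algebra_simps) linarith
qed

text \<open>The argument \<open>F\<close> is applied to the side of the doubled midpoint of an arc. It is strict
  positivity for the posets of the paper; weak positivity changes only the group of the arc whose
  midpoint lies on the line.\<close>

definition diag_step :: "nat^3 \<Rightarrow> nat \<Rightarrow> nat \<Rightarrow> (int \<Rightarrow> bool) \<Rightarrow> nat \<Rightarrow> mat2" where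
  "diag_step k p q F c = (let m = level p q c in
     group_matrix (k $ 1) (xhat $ 1) (F (side p q (2 * m + 1) (2 * int c - 2 * m - 1))))"

text \<open>The links are forced. A horizontal arc shares its left end, which lies left of the line,
  with the preceding diagonal arc, and its right end, which lies right of the line, with the next
  one. For a vertical arc the shared ends are first the lower one, right of the line, then the upper
  one, left of it.\<close>

definition horizontal_matrix :: "nat^3 \<Rightarrow> bool \<Rightarrow> mat2" where
  "horizontal_matrix k e = link False ** group_matrix (k $ 3) (xhat $ 3) e ** link True"

definition vertical_matrix :: "nat^3 \<Rightarrow> bool \<Rightarrow> mat2" where
  "vertical_matrix k e = link True ** group_matrix (k $ 2) (xhat $ 2) e ** link False"

definition axis_step :: "nat^3 \<Rightarrow> nat \<Rightarrow> nat \<Rightarrow> (int \<Rightarrow> bool) \<Rightarrow> nat \<Rightarrow> mat2" where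
  "axis_step k p q F c = (let m = level p q c in
     if level p q (Suc c) = m then horizontal_matrix k (F (side p q (2 * m + 1) (2 * (int c - m))))
     else vertical_matrix k (F (side p q (2 * m + 2) (2 * int c - 2 * m - 1))))"

abbreviation line_walk :: "nat^3 \<Rightarrow> nat \<Rightarrow> nat \<Rightarrow> (int \<Rightarrow> bool) \<Rightarrow> nat \<Rightarrow> nat \<Rightarrow> mat2" where
  "line_walk k p q F \<equiv> walk (diag_step k p q F) (axis_step k p q F)"

text \<open>The antidiagonals strictly between the ends of the line are
  \<open>1, ..., p + q - 1\<close>, with \<open>p + q - 2\<close> passages between them.\<close>

definition path_matrix :: "nat^3 \<Rightarrow> nat \<Rightarrow> nat \<Rightarrow> (int \<Rightarrow> bool) \<Rightarrow> mat2" where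
  "path_matrix k p q F = line_walk k p q F 1 (p + q - 2)"

lemmas mat2_simps = vec_eq_iff forall_2 matrix_matrix_mult_def sum_2

lemma transpose_group_matrix: "transpose (group_matrix n h e) = group_matrix n h (\<not> e)"
  by (simp add: group_matrix_def transpose_def mat2_simps)

lemma transpose_link: "transpose (link e) = link (\<not> e)"
  by (simp add: link_def transpose_def mat2_simps)

lemma transpose_axis_matrices:
  "transpose (horizontal_matrix k e) = horizontal_matrix k (\<not> e)"
  "transpose (vertical_matrix k e) = vertical_matrix k (\<not> e)"
  by (simp_all add: horizontal_matrix_def vertical_matrix_def matrix_transpose_mul
      transpose_group_matrix transpose_link matrix_mul_assoc)

text \<open>The half turn about the midpoint of the line reverses the order of the arcs and
  exchanges the sides; transposition reverses products and flips orientations. The negated strict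
  test at the mirrored point is the weak test.\<close>

lemma path_matrix_transpose:
  assumes "coprime p q" "p > 0" "q > 0"
  shows "path_matrix k p q (\<lambda>v. v \<ge> 0) = transpose (path_matrix k p q (\<lambda>v. v > 0))"
  unfolding path_matrix_def
proof (rule walk_transpose)
  \<comment> \<open>The half turn in doubled coordinates, in which midpoints of arcs are
    integral.\<close>
  have mirror: "side p q x y = - side p q (2 * int q - x) (2 * int p - y)" for x y
    by (simp add: side_def algebra_simps)
  \<comment> \<open>The half turn exchanges the ends of an arc: the new left end is the image of the
    old right end, at abscissa \<open>q - (m + 1)\<close> for
    \<open>m = level p q c\<close>.\<close>
  have level: "level p q (p + q - c) = int q - 1 - level p q c" if c: "0 < c" "c < p + q" for c
  proof (rule level_eqI)
    let ?m = "level p q c"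
    have "side p q (int q - 1 - ?m) (int (p + q - c) - (int q - 1 - ?m)) =
        - side p q (?m + 1) (int c - ?m - 1)"
      using c by (simp add: side_def of_nat_diff algebra_simps)
    then show "0 \<le> side p q (int q - 1 - ?m) (int (p + q - c) - (int q - 1 - ?m))"
      using level_bounds(2)[OF assms(1) c] by simp
    have "side p q (int q - 1 - ?m + 1) (int (p + q - c) - (int q - 1 - ?m) - 1) =
        - side p q ?m (int c - ?m)"
      using c by (simp add: side_def of_nat_diff algebra_simps)
    then show "side p q (int q - 1 - ?m + 1) (int (p + q - c) - (int q - 1 - ?m) - 1) < 0"
      using level_bounds(1)[OF assms(1) c] by simp
  qed
  fix i
  {
    assume "i \<le> p + q - 2"
    then have c: "0 < 1 + i" "1 + i < p + q" "1 + (p + q - 2 - i) = p + q - (1 + i)"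
      "int (p + q - (1 + i)) = int p + int q - 1 - int i"
      using assms by auto
    show "diag_step k p q (\<lambda>v. v \<ge> 0) (1 + i) =
        transpose (diag_step k p q (\<lambda>v. v > 0) (1 + (p + q - 2 - i)))"
      unfolding diag_step_def Let_def c(3) level[OF c(1,2)] transpose_group_matrix c(4)
      by (subst mirror) (simp add: not_less algebra_simps)
  }
  {
    assume "i < p + q - 2"
    then have c: "0 < 1 + i" "1 + i < p + q" "0 < Suc (1 + i)" "Suc (1 + i) < p + q"
      "1 + (p + q - 2 - Suc i) = p + q - Suc (1 + i)" 
      "Suc (p + q - Suc (1 + i)) = p + q - (1 + i)"
      "int (p + q - Suc (1 + i)) = int p + int q - 2 - int i"
      using assms by auto
    have neq: "level p q (Suc (1 + i)) \<noteq> level p q (1 + i) \<Longrightarrow> level p q (Suc (1 + i)) = level p q (1 + i) + 1"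
      using level_Suc_cases[of p q "1 + i"] assms by auto
    show "axis_step k p q (\<lambda>v. v \<ge> 0) (1 + i) =
        transpose (axis_step k p q (\<lambda>v. v > 0) (1 + (p + q - 2 - Suc i)))"
    proof (cases "level p q (Suc (1 + i)) = level p q (1 + i)")
      case True
      then show ?thesis
        unfolding axis_step_def Let_def c(5,6) level[OF c(1,2)] level[OF c(3,4)] c(7)
        by (subst mirror) (simp add: transpose_axis_matrices not_less algebra_simps)
    next
      case False
      then show ?thesis
        unfolding axis_step_def Let_def c(5,6) level[OF c(1,2)] level[OF c(3,4)] c(7) neq[OF False]
        by (subst mirror) (simp add: transpose_axis_matrices not_less algebra_simps)
    qed
  }
qed

section \<open>Walks at a mediant\<close>

lemma coprime_if_det:
  fixes p q r s :: nat
  assumes "q * r = p * s + 1"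
  shows "coprime p q" "coprime r s"
proof -
  have 1: "int q * int r - int p * int s = 1"
    using assms by (metis add_diff_cancel_left' of_nat_1 of_nat_add of_nat_mult)
  have "is_unit d" if "d dvd int p" "d dvd int q" for d
    using dvd_diff[OF dvd_mult2[OF that(2), of "int r"] dvd_mult2[OF that(1), of "int s"]] 1 by simp
  then have "coprime (int p) (int q)" by (intro coprimeI)
  then show "coprime p q" by simp
  have "is_unit d" if "d dvd int r" "d dvd int s" for d
    using dvd_diff[OF dvd_mult[OF that(1), of "int q"] dvd_mult[OF that(2), of "int p"]] 1 by simp
  then have "coprime (int r) (int s)" by (intro coprimeI)
  then show "coprime r s" by simp
qed

text \<open>With \<open>u\<close>, \<open>v\<close> the sides of a point with respect to the two lines of a Farey pair, and \<open>c\<close> the sum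
  of its coordinates, these are the facts that no (half-)lattice point lies strictly inside the
  triangle spanned by the pair.\<close>

lemma strip_signs:
  fixes a b u v c :: int
  assumes "a > 0" "b > 0" "c = b * u - a * v" "c > 0"
  shows "u \<le> 0 \<Longrightarrow> v < 0" "v \<ge> 0 \<Longrightarrow> u > 0" 
    "c < j * a \<Longrightarrow> u \<ge> 0 \<Longrightarrow> v > - j" "c < j * b \<Longrightarrow> v \<le> 0 \<Longrightarrow> u < j"
proof -
  show "v < 0" if "u \<le> 0"
  proof (rule ccontr)
    assume "\<not> v < 0"
    then have "a * v \<ge> 0" "b * u \<le> 0" using assms that by (auto simp: mult_nonneg_nonpos)
    then show False using assms by simp
  qed
  show "u > 0" if "v \<ge> 0"
  proof (rule ccontr)
    assume "\<not> u > 0"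
    then have "a * v \<ge> 0" "b * u \<le> 0" using assms that by (auto simp: mult_nonneg_nonpos)
    then show False using assms by simp
  qed
  show "v > - j" if "c < j * a" "u \<ge> 0"
  proof (rule ccontr)
    assume "\<not> v > - j"
    then have "a * v \<le> a * (- j)" using assms by (intro mult_left_mono) auto
    moreover have "b * u \<ge> 0" using assms that by simp
    ultimately show False using assms(3) that(1) mult.commute[of j a] by linarith
  qed
  show "u < j" if "c < j * b" "v \<le> 0"
  proof (rule ccontr)
    assume "\<not> u < j"
    then have "b * u \<ge> b * j" using assms by (intro mult_left_mono) auto
    moreover have "a * v \<le> 0" using assms that by (simp add: mult_nonneg_nonpos)
    ultimately show False using assms(3) that(1) mult.commute[of j b] by linarith
  qed
qed

context
  fixes p q r s :: nat
  assumes det: "q * r = p * s + 1"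
begin

lemma det_int: "int q * int r = int p * int s + 1"
  using det by (metis of_nat_1 of_nat_add of_nat_mult)

lemma qr_pos: "q > 0" "r > 0"
  using det by (metis Suc_eq_plus1 bot_nat_0.not_eq_extremum mult_0 nat.simps(3))
    (metis det Suc_eq_plus1 bot_nat_0.not_eq_extremum mult_0_right nat.simps(3))

lemma side_add: "side (p + r) (q + s) x y = side p q x y + side r s x y"
  by (simp add: side_def algebra_simps)

text \<open>By determinant one the two sides are unimodular coordinates of the plane. In them
  \<open>x + y\<close> takes the form that \<open>strip_signs\<close> asks for.\<close>

lemma side_strip: "x + y = int (r + s) * side p q x y - int (p + q) * side r s x y"
proof -
  have "int (r + s) * side p q x y - int (p + q) * side r s x y =
      (int q * int r - int p * int s) * (x + y)"
    by (simp add: side_def algebra_simps)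
  then show ?thesis using det_int by simp
qed

lemmas side_signs = strip_signs[OF _ _ side_strip]

text \<open>The second line is attached at \<open>(q, p)\<close>, a point right of the mediant's
  line with side \<open>-1\<close>.\<close>

lemma side_shift:
  "side (p + r) (q + s) (int q + x) (int p + y) = side p q x y + side r s x y - 1"
  using det_int by (simp add: side_def algebra_simps)

text \<open>Before the antidiagonal through \<open>(q, p)\<close> no lattice point separates the
  mediant's line from the first line, so both cross the same diagonal arcs.\<close>

lemma level_first: 
  assumes c: "0 < c" "c < p + q"
  shows "level (p + r) (q + s) c = level p q c"
proof (rule level_eqI)
  let ?m = "level p q c"
  note b = level_bounds[OF coprime_if_det(1)[OF det] c]
  have "side r s ?m (int c - ?m) > - 1"
    using side_signs(3)[of ?m "int c - ?m" 1] c b(1) qr_pos by simp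
  then show "side (p + r) (q + s) ?m (int c - ?m) \<ge> 0" using b by (simp add: side_add)
  have "side r s (?m + 1) (int c - ?m - 1) < 0"
    using side_signs(1)[of "?m + 1" "int c - ?m - 1"] c b(2) qr_pos by simp
  then show "side (p + r) (q + s) (?m + 1) (int c - ?m - 1) < 0" using b by (simp add: side_add)
qed

text \<open>The side with respect to the first line is at least 1 at left ends and at most 0 at
  right ends, which absorbs the \<open>-1\<close> of \<open>side_shift\<close>.\<close>

lemma level_second: 
  assumes c: "0 < c" "c < r + s"
  shows "level (p + r) (q + s) (p + q + c) = int q + level r s c"
proof (rule level_eqI)
  let ?m = "level r s c"
  note b = level_bounds[OF coprime_if_det(2)[OF det] c]
  have "side p q ?m (int c - ?m) > 0"
    using side_signs(2)[of ?m "int c - ?m"] c b(1) qr_pos by simp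
  then show "side (p + r) (q + s) (int q + ?m) (int (p + q + c) - (int q + ?m)) \<ge> 0"
    using b side_shift[of ?m "int c - ?m"] by (simp add: algebra_simps)
  have "side p q (?m + 1) (int c - ?m - 1) < 1"
    using side_signs(4)[of "?m + 1" "int c - ?m - 1" 1] c b(2) qr_pos by simp
  then show "side (p + r) (q + s) (int q + ?m + 1) (int (p + q + c) - (int q + ?m) - 1) < 0"
    using b side_shift[of "?m + 1" "int c - ?m - 1"] by (simp add: algebra_simps)
qed

text \<open>The arc crossed on this antidiagonal has \<open>(q, p)\<close> as its right end, where
  the first line stops and the second starts.\<close>

lemma level_middle: "level (p + r) (q + s) (p + q) = int q - 1"
proof (rule level_eqI)
  show "side (p + r) (q + s) (int q - 1) (int (p + q) - (int q - 1)) \<ge> 0"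
    using det_int qr_pos by (simp add: side_def algebra_simps)
  show "side (p + r) (q + s) (int q - 1 + 1) (int (p + q) - (int q - 1) - 1) < 0"
    using det_int qr_pos by (simp add: side_def algebra_simps)
qed

text \<open>Meant for doubled midpoints, hence the bound with factor 2. A midpoint left of the first
  line falls at worst onto the mediant's line, and one on the first line falls to the right of it;
  so the weak test for the mediant matches the strict one for the first line.\<close>

lemma flag_first:
  assumes "0 < x + y" "x + y < 2 * int (p + q)"
  shows "side (p + r) (q + s) x y \<ge> 0 \<longleftrightarrow> side p q x y > 0"
proof -
  have "side p q x y \<le> 0 \<Longrightarrow> side r s x y < 0" "side p q x y \<ge> 0 \<Longrightarrow> side r s x y > - 2"
    using side_signs(1,3)[of x y] assms qr_pos by auto
  then show ?thesis unfolding side_add by linarith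
qed

text \<open>In doubled coordinates the shift to \<open>(q, p)\<close> costs 2. Left of the second
  line both sides are at least 1, which just suffices; otherwise their sum is at most 1.\<close>

lemma flag_second:
  assumes "0 < x + y" "x + y < 2 * int (r + s)"
  shows "side (p + r) (q + s) (2 * int q + x) (2 * int p + y) \<ge> 0 \<longleftrightarrow> side r s x y > 0"
proof -
  have "side r s x y \<ge> 0 \<Longrightarrow> side p q x y > 0" "side r s x y \<le> 0 \<Longrightarrow> side p q x y < 2"
    using side_signs(2,4)[of x y] assms qr_pos by auto
  moreover have "side (p + r) (q + s) (2 * int q + x) (2 * int p + y) = side p q x y + side r s x y - 2"
    using det_int by (simp add: side_def algebra_simps)
  ultimately show ?thesis by linarith
qed

context
  fixes k :: "nat^3"
begin

abbreviation (input) "D \<equiv> diag_step k (p + r) (q + s) (\<lambda>v. v \<ge> 0)"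
abbreviation (input) "S \<equiv> axis_step k (p + r) (q + s) (\<lambda>v. v \<ge> 0)"

lemma diag_first: "0 < c \<Longrightarrow> c < p + q \<Longrightarrow> D c = diag_step k p q (\<lambda>v. v > 0) c"
  unfolding diag_step_def Let_def by (simp only: level_first, subst flag_first) auto

lemma axis_first:
  assumes "0 < c" "Suc c < p + q"
  shows "S c = axis_step k p q (\<lambda>v. v > 0) c"
proof -
  let ?m = "level p q c"
  have "side (p + r) (q + s) (2 * ?m + 1) (2 * (int c - ?m)) \<ge> 0
      \<longleftrightarrow> side p q (2 * ?m + 1) (2 * (int c - ?m)) > 0"
    "side (p + r) (q + s) (2 * ?m + 2) (2 * int c - 2 * ?m - 1) \<ge> 0
      \<longleftrightarrow> side p q (2 * ?m + 2) (2 * int c - 2 * ?m - 1) > 0"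
    using assms by (auto intro!: flag_first)
  then show ?thesis using assms unfolding axis_step_def Let_def by (simp add: level_first)
qed

lemma diag_second: 
  assumes "0 < c" "c < r + s"
  shows "D (p + q + c) = diag_step k r s (\<lambda>v. v > 0) c"
proof -
  let ?m = "level r s c"
  have "side (p + r) (q + s) (2 * (int q + ?m) + 1) (2 * int (p + q + c) - 2 * (int q + ?m) - 1) \<ge> 0
      \<longleftrightarrow> side r s (2 * ?m + 1) (2 * int c - 2 * ?m - 1) > 0"
    using flag_second[of "2 * ?m + 1" "2 * int c - 2 * ?m - 1"] assms by (simp add: algebra_simps)
  then show ?thesis unfolding diag_step_def Let_def level_second[OF assms] by simp
qed

lemma axis_second:
  assumes "0 < c" "Suc c < r + s"
  shows "S (p + q + c) = axis_step k r s (\<lambda>v. v > 0) c"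
proof -
  let ?m = "level r s c"
  have "side (p + r) (q + s) (2 * (int q + ?m) + 1) (2 * (int (p + q + c) - (int q + ?m))) \<ge> 0
      \<longleftrightarrow> side r s (2 * ?m + 1) (2 * (int c - ?m)) > 0"
    using flag_second[of "2 * ?m + 1" "2 * (int c - ?m)"] assms by (simp add: algebra_simps)
  moreover have "side (p + r) (q + s) (2 * (int q + ?m) + 2) (2 * int (p + q + c) - 2 * (int q + ?m) - 1) \<ge> 0
      \<longleftrightarrow> side r s (2 * ?m + 2) (2 * int c - 2 * ?m - 1) > 0"
    using flag_second[of "2 * ?m + 2" "2 * int c - 2 * ?m - 1"] assms by (simp add: algebra_simps)
  moreover have "level (p + r) (q + s) (Suc (p + q + c)) = int q + level r s (Suc c)"
    using level_second[of "Suc c"] assms by simp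
  moreover have "level (p + r) (q + s) (p + q + c) = int q + level r s c"
    using level_second[of c] assms by simp
  ultimately show ?thesis unfolding axis_step_def Let_def by simp
qed

text \<open>Up to three arcs of the mediant's walk meet at \<open>(q, p)\<close> and belong to
  neither partial walk: a horizontal arc ending there, this diagonal arc, and a vertical arc
  starting there. Their midpoints are not right of the mediant's line, so their flags are
  \<open>True\<close>.\<close>

lemma diag_middle: "D (p + q) = group_matrix (k $ 1) (xhat $ 1) True"
proof -
  have "side (p + r) (q + s) (2 * (int q - 1) + 1) (2 * int (p + q) - 2 * (int q - 1) - 1) \<ge> 0"
    using det_int qr_pos by (simp add: side_def algebra_simps)
  then show ?thesis unfolding diag_step_def Let_def level_middle by simp
qed

lemma axis_before_middle:
  assumes "p > 0"
  shows "S (p + q - 1) = horizontal_matrix k True"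
proof -
  have l: "level (p + r) (q + s) (p + q - 1) = int q - 1"
  proof (rule level_eqI)
    show "side (p + r) (q + s) (int q - 1) (int (p + q - 1) - (int q - 1)) \<ge> 0"
      using det_int assms by (simp add: side_def of_nat_diff algebra_simps)
    show "side (p + r) (q + s) (int q - 1 + 1) (int (p + q - 1) - (int q - 1) - 1) < 0"
      using det_int assms by (simp add: side_def of_nat_diff algebra_simps)
  qed
  have "side (p + r) (q + s) (2 * (int q - 1) + 1) (2 * (int (p + q - 1) - (int q - 1))) \<ge> 0"
    using det_int assms qr_pos by (simp add: side_def of_nat_diff algebra_simps)
  moreover have "Suc (p + q - 1) = p + q" using assms by simp
  ultimately show ?thesis unfolding axis_step_def Let_def l by (simp add: level_middle)
qed

lemma axis_after_middle:
  assumes "s > 0"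
  shows "S (p + q) = vertical_matrix k True"
proof -
  have l: "level (p + r) (q + s) (Suc (p + q)) = int q"
  proof (rule level_eqI)
    show "side (p + r) (q + s) (int q) (int (Suc (p + q)) - int q) \<ge> 0"
      using det_int assms by (simp add: side_def algebra_simps)
    show "side (p + r) (q + s) (int q + 1) (int (Suc (p + q)) - int q - 1) < 0"
      using det_int assms qr_pos by (simp add: side_def algebra_simps)
  qed
  have "side (p + r) (q + s) (2 * (int q - 1) + 2) (2 * int (p + q) - 2 * (int q - 1) - 1) \<ge> 0"
    using det_int assms qr_pos by (simp add: side_def algebra_simps)
  then show ?thesis unfolding axis_step_def Let_def l level_middle by simp
qed

text \<open>The walk is cut around \<open>(q, p)\<close>. For \<open>p = 0\<close> or
  \<open>s = 0\<close> that member of the pair is \<open>0/1\<close> or \<open>1/0\<close>, whose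
  line runs along an axis, and its part of the walk is absent.\<close>

lemma path_matrix_mediant:
  defines "G \<equiv> group_matrix (k $ 1) (xhat $ 1) True"
  shows "path_matrix k (p + r) (q + s) (\<lambda>v. v \<ge> 0) =
    (if p = 0 then mat 1 else path_matrix k p q (\<lambda>v. v > 0) ** horizontal_matrix k True) ** G **
    (if s = 0 then mat 1 else vertical_matrix k True ** path_matrix k r s (\<lambda>v. v > 0))"
proof -
  let ?n = "p + q" and ?n' = "r + s"
  have second: "walk D S ?n (?n' - 1) = G **
    (if s = 0 then mat 1 else vertical_matrix k True ** path_matrix k r s (\<lambda>v. v > 0))"
  proof (cases "s = 0")
    case True
    then have "?n' = 1" using det by simp
    then have "?n' - 1 = 0" by simp
    then have "walk D S ?n (?n' - 1) = D ?n" by (metis walk.simps(1))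
    also have "\<dots> = G" unfolding G_def by (rule diag_middle)
    finally have "walk D S ?n (?n' - 1) = G" .
    then show ?thesis using True by simp
  next
    case False
    define l where "l = ?n' - 2"
    have l: "?n' - 1 = Suc l" "?n' - 2 = l" using False qr_pos by (auto simp: l_def)
    have "walk D S (Suc ?n) l = line_walk k r s (\<lambda>v. v > 0) 1 l"
    proof (rule walk_cong)
      show "D (Suc ?n + i) = diag_step k r s (\<lambda>v. v > 0) (1 + i)" if "i \<le> l" for i
        using diag_second[of "1 + i"] that l by (simp add: add_ac)
      show "S (Suc ?n + i) = axis_step k r s (\<lambda>v. v > 0) (1 + i)" if "i < l" for i
        using axis_second[of "1 + i"] that l by (simp add: add_ac)
    qed
    then show ?thesis using False l
      by (simp add: diag_middle axis_after_middle G_def path_matrix_def matrix_mul_assoc)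
  qed
  show ?thesis
  proof (cases "p = 0")
    case True
    then have "q = 1" using det by simp
    then show ?thesis using second True by (simp add: path_matrix_def)
  next
    case False
    have "walk D S 1 (p + q - 2) = line_walk k p q (\<lambda>v. v > 0) 1 (p + q - 2)"
    proof (rule walk_cong)
      show "D (1 + i) = diag_step k p q (\<lambda>v. v > 0) (1 + i)" if "i \<le> p + q - 2" for i
        using diag_first[of "1 + i"] that False qr_pos by simp
      show "S (1 + i) = axis_step k p q (\<lambda>v. v > 0) (1 + i)" if "i < p + q - 2" for i
        using axis_first[of "1 + i"] that False qr_pos by simp
    qed
    \<comment> \<open>Lengths add up: the first walk, one horizontal passage, and the walk that
      starts at the middle antidiagonal.\<close>
    moreover have "p + r + (q + s) - 2 = Suc ((p + q - 2) + (?n' - 1))"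
      "1 + (p + q - 2) = p + q - 1" "Suc (p + q - 1) = p + q"
      using False qr_pos by auto
    ultimately show ?thesis
      using False second
      by (simp only: path_matrix_def walk_append axis_before_middle if_False) (simp add: matrix_mul_assoc)
  qed
qed

end

end

section \<open>The arcs crossed by a line\<close>

definition real_side :: "nat \<Rightarrow> nat \<Rightarrow> real \<times> real \<Rightarrow> real" where
  "real_side p q z = of_nat q * snd z - of_nat p * fst z"

abbreviation point :: "int \<Rightarrow> int \<Rightarrow> real \<times> real" where
  "point x y \<equiv> (of_int x, of_int y)"

lemma real_side_point: "real_side p q (point x y) = of_int (side p q x y)"
  by (simp add: real_side_def side_def)

definition height :: "real \<times> real \<Rightarrow> real" where "height z = fst z + snd z"

text \<open>Height is proportional to the parameter of the segment, so bounds on it cut the open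
  segment out of the line.\<close>

lemma gamma_iff:
  assumes "p > 0" "q > 0"
  shows "z \<in> gamma p q \<longleftrightarrow> real_side p q z = 0 \<and> 0 < height z \<and> height z < real (p + q)"
proof
  assume "z \<in> gamma p q"
  then obtain u where u: "0 < u" "u < 1" "z = (1 - u) *\<^sub>R (0, 0) + u *\<^sub>R (real q, real p)"
    unfolding gamma_def in_segment by blast
  then have z: "z = (u * q, u * p)" by simp
  then have "height z = u * real (p + q)" by (simp add: height_def algebra_simps)
  then show "real_side p q z = 0 \<and> 0 < height z \<and> height z < real (p + q)"
    using u(1,2) z assms by (simp add: real_side_def mult_less_cancel_right1)
next
  assume *: "real_side p q z = 0 \<and> 0 < height z \<and> height z < real (p + q)"
  define u where "u = height z / real (p + q)"
  have pq: "real q + real p > 0" using assms by simp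
  have u: "0 < u" "u < 1" using * assms by (auto simp: u_def)
  have "q * (fst z + snd z) = (real q + real p) * fst z" "p * (fst z + snd z) = (real q + real p) * snd z"
    using * by (simp_all add: real_side_def algebra_simps)
  then have "z = (u * q, u * p)" using pq
    by (cases z) (simp add: u_def height_def field_simps)
  then show "z \<in> gamma p q" using u assms
    unfolding gamma_def in_segment by (auto intro!: exI[of _ u])
qed

text \<open>One computation for all three kinds of arcs. The side is affine along the arc and
  changes sign, so it has a single zero \<open>t\<close>, measured from the right end; the height
  bounds place it inside the segment. Being closer to the right end means \<open>t < 1/2\<close>,
  that is, the midpoint lies on the left.\<close>

lemma crossing_characterization:
  fixes R L :: "real \<times> real"
  assumes pq: "p > 0" "q > 0" and \<tau>: "snd \<tau> = (R, L) \<or> snd \<tau> = (L, R)"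
    and sides: "real_side p q R < 0" "real_side p q L > 0"
    and heights: "\<And>u. 0 < u \<Longrightarrow> u < 1 \<Longrightarrow>
      0 < (1 - u) * height R + u * height L \<and> (1 - u) * height R + u * height L < real (p + q)"
  shows "gamma p q \<inter> segment \<tau> \<noteq> {}"
    and "\<exists>u. 0 < u \<and> u < 1 \<and>
      fst (crossing_point p q \<tau>) = real q * ((1 - u) * height R + u * height L) / real (p + q)"
    and "closer_to_right p q \<tau> \<longleftrightarrow> real_side p q R + real_side p q L > 0"
proof -
  define t where "t = real_side p q R / (real_side p q R - real_side p q L)"
  define z where "z = (1 - t) *\<^sub>R R + t *\<^sub>R L"
  have t: "0 < t" "t < 1" using sides by (auto simp: t_def field_simps)
  have seg: "segment \<tau> = closed_segment R L" and ends: "endpoints \<tau> = {R, L}"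
    using \<tau> by (auto simp: closed_segment_commute)
  have lin: "real_side p q ((1 - u) *\<^sub>R R + u *\<^sub>R L) = (1 - u) * real_side p q R + u * real_side p q L"
    "height ((1 - u) *\<^sub>R R + u *\<^sub>R L) = (1 - u) * height R + u * height L" for u
    by (simp_all add: real_side_def height_def algebra_simps)
  have root: "(1 - u) * real_side p q R + u * real_side p q L = 0 \<longleftrightarrow> u = t" for u
    using sides by (simp add: t_def field_simps) argo
  have z_gamma: "z \<in> gamma p q"
    using heights[OF t] root[of t] unfolding gamma_iff[OF pq] by (simp add: z_def lin)
  have "z \<in> closed_segment R L" unfolding in_segment z_def using t by (metis less_imp_le)
  moreover have "w = z" if "w \<in> gamma p q \<inter> closed_segment R L" for w
  proof -
    from that obtain u where u: "w = (1 - u) *\<^sub>R R + u *\<^sub>R L" by (auto simp: in_segment)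
    have "real_side p q w = 0" using that gamma_iff[OF pq] by blast
    then have "u = t" unfolding u lin root .
    then show ?thesis by (simp add: u z_def)
  qed
  ultimately have inter: "gamma p q \<inter> segment \<tau> = {z}" using z_gamma unfolding seg by blast
  then have cp: "crossing_point p q \<tau> = z" by (simp add: crossing_point_def)
  show "gamma p q \<inter> segment \<tau> \<noteq> {}" using inter by simp
  have "real q * height z = real (p + q) * fst z"
    using z_gamma unfolding gamma_iff[OF pq] by (simp add: real_side_def height_def algebra_simps)
  then have "fst z = real q * height z / real (p + q)" using pq by (simp add: field_simps)
  then show "\<exists>u. 0 < u \<and> u < 1 \<and>
      fst (crossing_point p q \<tau>) = real q * ((1 - u) * height R + u * height L) / real (p + q)"
    using t unfolding cp by (intro exI[of _ t]) (simp add: z_def lin)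
  have "(THE w. w \<in> endpoints \<tau> \<and> right_of p q w) = R" "(THE w. w \<in> endpoints \<tau> \<and> left_of p q w) = L"
    unfolding ends right_of_def left_of_def using sides
    by (auto simp: real_side_def intro!: the_equality)
  moreover have "z - R = t *\<^sub>R (L - R)" "z - L = (1 - t) *\<^sub>R (R - L)"
    by (simp_all add: z_def algebra_simps)
  then have "dist z R = t * dist R L" "dist z L = (1 - t) * dist R L"
    using t unfolding dist_norm by (simp_all add: norm_minus_commute)
  moreover have "dist R L > 0" using sides by auto
  ultimately have "closer_to_right p q \<tau> \<longleftrightarrow> t < 1 - t"
    unfolding closer_to_right_def cp by simp
  also have "\<dots> \<longleftrightarrow> 2 * t * (real_side p q L - real_side p q R) < 1 * (real_side p q L - real_side p q R)"
    using sides by (subst mult_less_cancel_right_pos) auto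
  also have "2 * t * (real_side p q L - real_side p q R) = - 2 * real_side p q R"
    using sides by (simp add: t_def field_simps)
  also have "\<dots> < 1 * (real_side p q L - real_side p q R) \<longleftrightarrow> real_side p q R + real_side p q L > 0"
    by auto
  finally show "closer_to_right p q \<tau> \<longleftrightarrow> real_side p q R + real_side p q L > 0" .
qed

section \<open>The list of crossed arcs\<close>

definition diag_arc :: "nat \<Rightarrow> nat \<Rightarrow> nat \<Rightarrow> arc" where
  "diag_arc p q c = (let m = level p q c in (1, point m (int c - m), point (m + 1) (int c - m - 1)))"

definition axis_arc :: "nat \<Rightarrow> nat \<Rightarrow> nat \<Rightarrow> arc" where
  "axis_arc p q c = (let m = level p q c in
     if level p q (Suc c) = m then (3, point m (int c - m), point (m + 1) (int c - m))
     else (2, point (m + 1) (int c - m - 1), point (m + 1) (int c - m)))"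

fun arcs_from :: "nat \<Rightarrow> nat \<Rightarrow> nat \<Rightarrow> nat \<Rightarrow> arc list" where
  "arcs_from p q c 0 = [diag_arc p q c]"
| "arcs_from p q c (Suc l) = diag_arc p q c # axis_arc p q c # arcs_from p q (Suc c) l"

lemma set_arcs_from:
  "set (arcs_from p q c l) = diag_arc p q ` {c..c + l} \<union> axis_arc p q ` {c..<c + l}"
proof (induction l arbitrary: c)
  case (Suc l)
  have "{c..c + Suc l} = insert c {Suc c..Suc c + l}" "{c..<c + Suc l} = insert c {Suc c..<Suc c + l}"
    by auto
  then show ?case using Suc by auto
qed simp

context
  fixes p q :: nat
  assumes pq: "p > 0" "q > 0" and coprime: "coprime p q"
begin

text \<open>A lattice point on the line would be the \<open>level\<close> point of its antidiagonal
  with side zero, against the strictness of \<open>level_bounds\<close>.\<close>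

lemma side_nonzero:
  assumes "0 < x + y" "x + y < int (p + q)"
  shows "side p q x y \<noteq> 0"
proof
  assume 0: "side p q x y = 0"
  define c where "c = nat (x + y)"
  have c: "0 < c" "c < p + q" "y = int c - x" using assms by (auto simp: c_def)
  have "side p q (x + 1) (int c - x - 1) < 0" using 0 pq c(3) by (simp add: side_def algebra_simps)
  then have "level p q c = x" using 0 c by (intro level_eqI) auto
  then show False using level_bounds(1)[OF coprime c(1,2)] 0 c(3) by simp
qed

lemma level_Suc_if_neq: "level p q (Suc c) \<noteq> level p q c \<Longrightarrow> level p q (Suc c) = level p q c + 1"
  using level_Suc_cases[of p q c] pq by auto

lemma diag_arc_crossing:
  assumes c: "0 < c" "c < p + q"
  defines "\<tau> \<equiv> diag_arc p q c" and "m \<equiv> level p q c"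
  shows "gamma p q \<inter> segment \<tau> \<noteq> {}"
    and "fst (crossing_point p q \<tau>) = real q * real c / real (p + q)"
    and "closer_to_right p q \<tau> \<longleftrightarrow> side p q (2 * m + 1) (2 * int c - 2 * m - 1) > 0"
proof -
  let ?R = "point (m + 1) (int c - m - 1)" and ?L = "point m (int c - m)"
  have \<tau>: "snd \<tau> = (?R, ?L) \<or> snd \<tau> = (?L, ?R)"
    by (simp add: \<tau>_def diag_arc_def m_def Let_def)
  have s: "real_side p q ?R < 0" "real_side p q ?L > 0"
    unfolding real_side_point using level_bounds[OF coprime c] by (simp_all add: m_def)
  have h: "(1 - u) * height ?R + u * height ?L = real c" for u
    by (simp add: height_def algebra_simps)
  have h': "0 < (1 - u) * height ?R + u * height ?L \<and> (1 - u) * height ?R + u * height ?L < real (p + q)" for u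
    unfolding h using c by simp
  note cr = crossing_characterization[OF pq \<tau> s h']
  show "gamma p q \<inter> segment \<tau> \<noteq> {}" by (rule cr(1))
  show "fst (crossing_point p q \<tau>) = real q * real c / real (p + q)"
    using cr(2) unfolding h by blast
  have "real_side p q ?R + real_side p q ?L = of_int (side p q (2 * m + 1) (2 * int c - 2 * m - 1))"
    by (simp add: real_side_def side_def algebra_simps)
  then show "closer_to_right p q \<tau> \<longleftrightarrow> side p q (2 * m + 1) (2 * int c - 2 * m - 1) > 0"
    using cr(3) by simp
qed

text \<open>Inside such an arc the height lies strictly between \<open>c\<close> and
  \<open>c + 1\<close>, which puts its crossing between those of the neighbouring diagonal arcs; the
  ordering of the list rests on this.\<close>

lemma axis_arc_crossing:
  assumes c: "0 < c" "Suc c < p + q"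
  defines "\<tau> \<equiv> axis_arc p q c" and "m \<equiv> level p q c"
  shows "gamma p q \<inter> segment \<tau> \<noteq> {}"
    and "real q * real c / real (p + q) < fst (crossing_point p q \<tau>)"
    and "fst (crossing_point p q \<tau>) < real q * real (Suc c) / real (p + q)"
    and "closer_to_right p q \<tau> \<longleftrightarrow>
      (if level p q (Suc c) = m then side p q (2 * m + 1) (2 * (int c - m)) > 0
       else side p q (2 * m + 2) (2 * int c - 2 * m - 1) > 0)"
proof -
  let ?h = "level p q (Suc c) = m"
  define R where "R = (if ?h then point (m + 1) (int c - m) else point (m + 1) (int c - m - 1))"
  define L where "L = (if ?h then point m (int c - m) else point (m + 1) (int c - m))"
  have \<tau>: "snd \<tau> = (R, L) \<or> snd \<tau> = (L, R)"
    by (simp add: \<tau>_def axis_arc_def m_def Let_def R_def L_def)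
  note b = level_bounds[OF coprime, of c] level_bounds[OF coprime, of "Suc c"]
  have s: "real_side p q R < 0" "real_side p q L > 0"
  proof -
    have R: "real_side p q R = of_int (if ?h then side p q (m + 1) (int c - m) else side p q (m + 1) (int c - m - 1))"
      by (cases ?h) (simp_all only: R_def real_side_point refl if_True if_False)
    have L: "real_side p q L = of_int (if ?h then side p q m (int c - m) else side p q (m + 1) (int c - m))"
      by (cases ?h) (simp_all only: L_def real_side_point refl if_True if_False)
    have "int (Suc c) - m - 1 = int c - m" "int (Suc c) - (m + 1) = int c - m" by simp_all
    then show "real_side p q R < 0" "real_side p q L > 0"
      unfolding R L using b c level_Suc_if_neq[of c] by (auto simp: m_def)
  qed
  have h: "(1 - u) * height R + u * height L = real c + (if ?h then 1 - u else u)" for u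
    by (simp add: height_def R_def L_def algebra_simps)
  have h': "0 < (1 - u) * height R + u * height L \<and> (1 - u) * height R + u * height L < real (p + q)"
    if "0 < u" "u < 1" for u
    unfolding h using c that by auto
  note cr = crossing_characterization[OF pq \<tau> s h', simplified]
  show "gamma p q \<inter> segment \<tau> \<noteq> {}" by (rule cr(1))
  obtain u where u: "0 < u" "u < 1"
      "fst (crossing_point p q \<tau>) = real q * (real c + (if ?h then 1 - u else u)) / real (p + q)"
    using cr(2) unfolding h by auto
  show "real q * real c / real (p + q) < fst (crossing_point p q \<tau>)"
    "fst (crossing_point p q \<tau>) < real q * real (Suc c) / real (p + q)"
    unfolding u(3) using u(1,2) pq by (intro divide_strict_right_mono mult_strict_left_mono; simp)+
  have "real_side p q R + real_side p q L = of_int (if ?h then side p q (2 * m + 1) (2 * (int c - m))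
       else side p q (2 * m + 2) (2 * int c - 2 * m - 1))"
    by (simp add: real_side_def side_def R_def L_def algebra_simps)
  then show "closer_to_right p q \<tau> \<longleftrightarrow>
      (if ?h then side p q (2 * m + 1) (2 * (int c - m)) > 0
       else side p q (2 * m + 2) (2 * int c - 2 * m - 1) > 0)"
    using cr(3) by simp
qed

lemma diag_arc_in_arcs: "diag_arc p q c \<in> arcs"
proof -
  have "\<exists>m' n. diag_arc p q c = (1, (of_int m', of_int (n + 1)), (of_int (m' + 1), of_int n))"
    by (intro exI[of _ "level p q c"] exI[of _ "int c - level p q c - 1"]) (simp add: diag_arc_def Let_def)
  then show ?thesis unfolding arcs_def by blast
qed

lemma axis_arc_in_arcs: "axis_arc p q c \<in> arcs"
proof (cases "level p q (Suc c) = level p q c")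
  case True
  then have "\<exists>m' n. axis_arc p q c = (3, (of_int m', of_int n), (of_int (m' + 1), of_int n))"
    by (intro exI[of _ "level p q c"] exI[of _ "int c - level p q c"]) (simp add: axis_arc_def Let_def)
  then show ?thesis unfolding arcs_def by blast
next
  case False
  then have "\<exists>m' n. axis_arc p q c = (2, (of_int m', of_int n), (of_int m', of_int (n + 1)))"
    by (intro exI[of _ "level p q c + 1"] exI[of _ "int c - level p q c - 1"]) (simp add: axis_arc_def Let_def)
  then show ?thesis unfolding arcs_def by blast
qed

text \<open>At the ends of an arc that meets the line the sides have weakly opposite signs. Once
  lattice points on the line are excluded, these signs determine \<open>level\<close> and so
  identify the arc.\<close>

lemma crossed_cases:
  assumes "\<tau> \<in> arcs" "z \<in> gamma p q" "z \<in> segment \<tau>"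
  shows "(\<exists>c. 0 < c \<and> c < p + q \<and> \<tau> = diag_arc p q c) \<or>
    (\<exists>c. 0 < c \<and> Suc c < p + q \<and> \<tau> = axis_arc p q c)"
proof -
  have z: "real q * snd z = real p * fst z" "0 < fst z + snd z" "fst z + snd z < real p + real q"
    using assms(2) unfolding gamma_iff[OF pq] by (simp_all add: real_side_def height_def)
  have "fst z = real q / (real p + real q) * (fst z + snd z)"
    "snd z = real p / (real p + real q) * (fst z + snd z)"
    using z(1) pq by (simp_all add: field_simps)
  then have z_pos: "fst z > 0" "snd z > 0" using z(2) pq
    by (metis divide_pos_pos mult_pos_pos of_nat_0_less_iff add_pos_pos)+
  \<comment> \<open>On the line the two bounds are equivalent, and they cannot both fail because the
    height is below \<open>p + q\<close>.\<close>
  have z_less: "fst z < real q" "snd z < real p"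
  proof -
    have "real q * snd z < real q * real p \<longleftrightarrow> fst z < real q"
      using z(1) pq by (simp add: mult.commute)
    then have "snd z < real p \<longleftrightarrow> fst z < real q" using pq by simp
    then show "fst z < real q" "snd z < real p" using z(3) by linarith+
  qed
  consider (diag) m n where "\<tau> = (1, point m (n + 1), point (m + 1) n)"
    | (vert) m n where "\<tau> = (2, point m n, point m (n + 1))"
    | (hor) m n where "\<tau> = (3, point m n, point (m + 1) n)"
    using assms(1) unfolding arcs_def by blast
  then show ?thesis
  proof cases
    case diag
    obtain u where u: "0 \<le> u" "u \<le> 1" "fst z = of_int m + u" "snd z = of_int n + 1 - u"
      using assms(3) diag by (auto simp: in_segment algebra_simps)
    define c where "c = nat (m + n + 1)"
    have mn: "0 < m + n + 1" "m + n + 1 < int (p + q)" using u z(2,3) by linarith+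
    then have c: "0 < c" "c < p + q" "int c = m + n + 1" by (auto simp: c_def)
    have "real q * (of_int n + 1) - real p * of_int m = u * (real p + real q)"
      "real q * of_int n - real p * (of_int m + 1) = (u - 1) * (real p + real q)"
      using z(1) u(3,4) by (simp_all add: algebra_simps)
    then have "real_side p q (point m (n + 1)) \<ge> 0" "real_side p q (point (m + 1) n) \<le> 0"
      using u(1,2) by (simp_all add: real_side_def mult_nonpos_nonneg)
    then have "side p q m (n + 1) \<ge> 0" "side p q (m + 1) n \<le> 0"
      unfolding real_side_point by simp_all
    \<comment> \<open>\<open>level_eqI\<close> tolerates a zero at the left end and asks for
      strictness at the right end.\<close>
    moreover have "side p q (m + 1) n \<noteq> 0" using mn by (intro side_nonzero) auto
    ultimately have "level p q c = m" using c by (intro level_eqI) (auto simp: algebra_simps)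
    then have "\<tau> = diag_arc p q c" using c by (simp add: diag diag_arc_def)
    then show ?thesis using c by blast
  next
    case vert
    obtain u where u: "0 \<le> u" "u \<le> 1" "fst z = of_int m" "snd z = of_int n + u"
      using assms(3) vert by (auto simp: in_segment algebra_simps)
    define c where "c = nat (m + n)"
    have mn: "0 < m" "m < int q" "n > - 1" "n < int p" using u z_pos z_less by linarith+
    then have c: "0 < c" "Suc c < p + q" "int c = m + n" by (auto simp: c_def)
    have "real q * of_int n - real p * of_int m = - u * real q"
      "real q * (of_int n + 1) - real p * of_int m = (1 - u) * real q"
      using z(1) u(3,4) by (simp_all add: algebra_simps)
    then have "real_side p q (point m n) \<le> 0" "real_side p q (point m (n + 1)) \<ge> 0"
      using u(1,2) by (simp_all add: real_side_def)
    then have "side p q m n \<le> 0" "side p q m (n + 1) \<ge> 0"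
      unfolding real_side_point by simp_all
    moreover have "side p q m n \<noteq> 0" using mn c by (intro side_nonzero) auto
    moreover have "side p q (m - 1) (n + 1) = side p q m (n + 1) + int p"
      "side p q (m + 1) n = side p q m n - int p"
      by (simp_all add: side_def algebra_simps)
    ultimately have sides: "0 \<le> side p q (m - 1) (n + 1)" "side p q m n < 0"
        "0 \<le> side p q m (n + 1)" "side p q (m + 1) n < 0"
      using pq by linarith+
    have "level p q c = m - 1" by (rule level_eqI) (use sides c in simp_all)
    moreover have "level p q (Suc c) = m" by (rule level_eqI) (use sides c in \<open>simp_all add: algebra_simps\<close>)
    ultimately have "\<tau> = axis_arc p q c" using c by (simp add: vert axis_arc_def)
    then show ?thesis using c by blast
  next
    case hor
    obtain u where u: "0 \<le> u" "u \<le> 1" "fst z = of_int m + u" "snd z = of_int n"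
      using assms(3) hor by (auto simp: in_segment algebra_simps)
    define c where "c = nat (m + n)"
    have mn: "0 < n" "n < int p" "m > - 1" "m < int q" using u z_pos z_less by linarith+
    then have c: "0 < c" "Suc c < p + q" "int c = m + n" by (auto simp: c_def)
    have "real q * of_int n - real p * of_int m = u * real p"
      "real q * of_int n - real p * (of_int m + 1) = (u - 1) * real p"
      using z(1) u(3,4) by (simp_all add: algebra_simps)
    then have "real_side p q (point m n) \<ge> 0" "real_side p q (point (m + 1) n) \<le> 0"
      using u(1,2) by (simp_all add: real_side_def mult_nonpos_nonneg)
    then have "side p q m n \<ge> 0" "side p q (m + 1) n \<le> 0"
      unfolding real_side_point by simp_all
    moreover have "side p q (m + 1) n \<noteq> 0" using mn c by (intro side_nonzero) auto
    moreover have "side p q m (n + 1) = side p q m n + int q"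
      "side p q (m + 1) (n - 1) = side p q (m + 1) n - int q"
      by (simp_all add: side_def algebra_simps)
    ultimately have sides: "0 \<le> side p q m n" "side p q (m + 1) (n - 1) < 0"
        "0 \<le> side p q m (n + 1)" "side p q (m + 1) n < 0"
      using pq by linarith+
    have "level p q c = m" by (rule level_eqI) (use sides c in simp_all)
    moreover have "level p q (Suc c) = m" by (rule level_eqI) (use sides c in \<open>simp_all add: algebra_simps\<close>)
    ultimately have "\<tau> = axis_arc p q c" using c by (simp add: hor axis_arc_def)
    then show ?thesis using c by blast
  qed
qed

lemma set_arcs_from_crossed: "set (arcs_from p q 1 (p + q - 2)) = crossed p q"
proof (intro equalityI subsetI)
  fix \<tau> assume "\<tau> \<in> set (arcs_from p q 1 (p + q - 2))"
  then show "\<tau> \<in> crossed p q"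
    unfolding set_arcs_from crossed_def
    using pq diag_arc_in_arcs axis_arc_in_arcs diag_arc_crossing(1) axis_arc_crossing(1) by auto
next
  fix \<tau> assume "\<tau> \<in> crossed p q"
  then obtain z where "\<tau> \<in> arcs" "z \<in> gamma p q" "z \<in> segment \<tau>"
    unfolding crossed_def by blast
  then show "\<tau> \<in> set (arcs_from p q 1 (p + q - 2))"
    unfolding set_arcs_from using crossed_cases[of \<tau> z] by fastforce
qed

abbreviation "key \<tau> \<equiv> fst (crossing_point p q \<tau>)"

text \<open>The lower bound on the keys is carried through the induction so that a new head can be
  compared with the whole tail.\<close>

lemma sorted_arcs_from:
  assumes "0 < c" "c + l < p + q"
  shows "sorted_wrt (\<lambda>\<tau> \<tau>'. key \<tau> < key \<tau>') (arcs_from p q c l) \<and>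
    (\<forall>\<tau> \<in> set (arcs_from p q c l). real q * real c / real (p + q) \<le> key \<tau>)"
  using assms
proof (induction l arbitrary: c)
  case 0
  then show ?case using diag_arc_crossing(2)[of c] by simp
next
  case (Suc l)
  have "key (diag_arc p q c) = real q * real c / real (p + q)"
    using diag_arc_crossing(2)[of c] Suc.prems by simp
  moreover have "real q * real c / real (p + q) < key (axis_arc p q c)"
    "key (axis_arc p q c) < real q * real (Suc c) / real (p + q)"
    using axis_arc_crossing(2,3)[of c] Suc.prems by simp_all
  ultimately show ?case using Suc.IH[of "Suc c"] Suc.prems by force
qed

lemma strict_key_sorted_unique:
  fixes f :: "'a \<Rightarrow> real"
  assumes "sorted_wrt (\<lambda>x y. f x < f y) xs" "sorted_wrt (\<lambda>x y. f x < f y) ys" "set xs = set ys"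
  shows "xs = ys"
proof -
  have "map f xs = map f ys"
    using assms by (intro strict_sorted_equal) (auto simp: sorted_wrt_map)
  moreover have "inj_on f (set ys)"
    using assms(2) by (metis distinct_map sorted_wrt_map strict_sorted_iff)
  ultimately show ?thesis using assms(3) by (metis map_inj_on sup.idem)
qed

text \<open>Strictly increasing keys determine a list from its set, which resolves the definite
  description.\<close>

lemma crossed_list_eq: "crossed_list p q = arcs_from p q 1 (p + q - 2)"
  unfolding crossed_list_def
proof (rule the_equality)
  have *: "sorted_wrt (\<lambda>\<tau> \<tau>'. key \<tau> < key \<tau>') (arcs_from p q 1 (p + q - 2))"
    using sorted_arcs_from[of 1 "p + q - 2"] pq by auto
  then show "set (arcs_from p q 1 (p + q - 2)) = crossed p q \<and>
      sorted_wrt (\<lambda>\<tau> \<tau>'. key \<tau> < key \<tau>') (arcs_from p q 1 (p + q - 2))"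
    using set_arcs_from_crossed by blast
  show "ts = arcs_from p q 1 (p + q - 2)"
    if "set ts = crossed p q \<and> sorted_wrt (\<lambda>\<tau> \<tau>'. key \<tau> < key \<tau>') ts" for ts
    using that * set_arcs_from_crossed by (intro strict_key_sorted_unique[of key]) auto
qed

lemma distinct_crossed_list: "distinct (crossed_list p q)"
proof -
  have "sorted_wrt (<) (map key (arcs_from p q 1 (p + q - 2)))"
    using sorted_arcs_from[of 1 "p + q - 2"] pq by (auto simp: sorted_wrt_map)
  then show ?thesis unfolding crossed_list_eq using strict_sorted_iff distinct_map by blast
qed

end

section \<open>The transfer matrix of the poset as a walk\<close>

definition arc_group :: "nat^3 \<Rightarrow> arc \<Rightarrow> (arc \<times> bool) list" where
  "arc_group k \<tau> = (if k $ label \<tau> = 0 then [(\<tau>, False)] else [(\<tau>, False), (\<tau>, True)])"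

lemma P_list_arc_group: "P_list k p q = concat (map (arc_group k) (crossed_list p q))"
  by (simp add: P_list_def arc_group_def[abs_def])

abbreviation arc_matrix :: "nat^3 \<Rightarrow> nat \<Rightarrow> nat \<Rightarrow> arc \<Rightarrow> mat2" where
  "arc_matrix k p q \<tau> \<equiv> group_matrix (k $ label \<tau>) (xhat $ label \<tau>) (closer_to_right p q \<tau>)"

lemma fence_matrix_group:
  "fence_matrix (P_gt p q) (P_wt k p q) (arc_group k \<tau>) = arc_matrix k p q \<tau>"
  by (auto simp: arc_group_def P_gt_def P_wt_def Let_def diag2_def link_def group_matrix_def mat2_simps
      power2_eq_square)

lemma fence_matrix_append:
  "xs \<noteq> [] \<Longrightarrow> fence_matrix gt wt (xs @ y # ys) =
     fence_matrix gt wt xs ** link (gt (last xs) y) ** fence_matrix gt wt (y # ys)"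
  by (induction gt wt xs rule: fence_matrix.induct) (simp_all add: matrix_mul_assoc)

lemma fence_matrix_group_append:
  assumes "\<tau> \<noteq> \<tau>'"
  shows "fence_matrix (P_gt p q) (P_wt k p q) (arc_group k \<tau> @ arc_group k \<tau>' @ ys) =
    arc_matrix k p q \<tau> ** link (right_of p q (shared_endpoint \<tau> \<tau>')) **
    fence_matrix (P_gt p q) (P_wt k p q) (arc_group k \<tau>' @ ys)"
proof -
  obtain zs where zs: "arc_group k \<tau>' @ ys = (\<tau>', False) # zs"
    by (cases "k $ label \<tau>' = 0") (auto simp: arc_group_def)
  have "P_gt p q (last (arc_group k \<tau>)) (\<tau>', False) = right_of p q (shared_endpoint \<tau> \<tau>')"
    using assms by (simp add: P_gt_def arc_group_def)
  then show ?thesis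
    unfolding zs by (simp add: fence_matrix_append arc_group_def[of k \<tau>] flip: fence_matrix_group)
qed

lemma right_of_point: "right_of p q (point x y) \<longleftrightarrow> side p q x y < 0"
proof -
  have "right_of p q (point x y) \<longleftrightarrow> real_side p q (point x y) < 0"
    by (simp add: right_of_def real_side_def)
  then show ?thesis unfolding real_side_point by simp
qed

lemma shared_endpointI:
  assumes "endpoints \<tau> \<inter> endpoints \<tau>' = {z}"
  shows "shared_endpoint \<tau> \<tau>' = z"
  unfolding shared_endpoint_def using assms by simp

context
  fixes p q :: nat
  assumes pq: "p > 0" "q > 0" and coprime: "coprime p q"
begin

lemma arc_matrix_diag_arc:
  assumes "0 < c" "c < p + q"
  shows "arc_matrix k p q (diag_arc p q c) = diag_step k p q (\<lambda>v. v > 0) c"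
proof -
  have "label (diag_arc p q c) = 1" by (simp add: diag_arc_def Let_def)
  then show ?thesis
    using diag_arc_crossing(3)[OF pq coprime assms] by (simp add: diag_step_def Let_def)
qed

text \<open>\<open>level_bounds\<close> on the two neighbouring antidiagonals decides on which side
  the shared endpoints lie, and this fixes both links.\<close>

lemma arc_matrix_axis_arc:
  assumes c: "0 < c" "Suc c < p + q"
  shows "link (right_of p q (shared_endpoint (diag_arc p q c) (axis_arc p q c))) **
      arc_matrix k p q (axis_arc p q c) **
      link (right_of p q (shared_endpoint (axis_arc p q c) (diag_arc p q (Suc c)))) =
    axis_step k p q (\<lambda>v. v > 0) c"
proof -
  let ?m = "level p q c"
  note b = level_bounds[OF coprime c(1)] level_bounds[OF coprime _ c(2)]
  note cr = axis_arc_crossing(4)[OF pq coprime c]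
  show ?thesis
  proof (cases "level p q (Suc c) = ?m")
    case True
    have "shared_endpoint (diag_arc p q c) (axis_arc p q c) = point ?m (int c - ?m)"
      by (rule shared_endpointI) (auto simp: diag_arc_def axis_arc_def Let_def True)
    moreover have "shared_endpoint (axis_arc p q c) (diag_arc p q (Suc c)) = point (?m + 1) (int (Suc c) - ?m - 1)"
      by (rule shared_endpointI) (auto simp: diag_arc_def axis_arc_def Let_def True)
    moreover have "label (axis_arc p q c) = 3" by (simp add: axis_arc_def Let_def True)
    moreover have "\<not> side p q ?m (int c - ?m) < 0" "side p q (?m + 1) (int (Suc c) - ?m - 1) < 0"
      using b c True by auto
    ultimately show ?thesis
      using cr by (simp only: right_of_point axis_step_def Let_def True horizontal_matrix_def if_True simp_thms)
  next
    case False
    then have Suc: "level p q (Suc c) = ?m + 1"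
      by (rule level_Suc_if_neq[OF pq coprime])
    have "shared_endpoint (diag_arc p q c) (axis_arc p q c) = point (?m + 1) (int c - ?m - 1)"
      by (rule shared_endpointI) (auto simp: diag_arc_def axis_arc_def Let_def Suc)
    moreover have "shared_endpoint (axis_arc p q c) (diag_arc p q (Suc c)) = point (?m + 1) (int (Suc c) - (?m + 1))"
      by (rule shared_endpointI) (auto simp: diag_arc_def axis_arc_def Let_def Suc)
    moreover have "label (axis_arc p q c) = 2" by (simp add: axis_arc_def Let_def Suc)
    moreover have "side p q (?m + 1) (int c - ?m - 1) < 0" "\<not> side p q (?m + 1) (int (Suc c) - (?m + 1)) < 0"
      using b c Suc by auto
    ultimately show ?thesis
      using cr False by (simp only: right_of_point axis_step_def Let_def vertical_matrix_def if_False simp_thms)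
  qed
qed

lemma fence_matrix_arcs_from:
  assumes "0 < c" "c + l < p + q"
  shows "fence_matrix (P_gt p q) (P_wt k p q) (concat (map (arc_group k) (arcs_from p q c l))) =
    line_walk k p q (\<lambda>v. v > 0) c l"
  using assms
proof (induction l arbitrary: c)
  case 0
  then show ?case by (simp add: fence_matrix_group arc_matrix_diag_arc)
next
  case (Suc l)
  obtain ts where ts: "arcs_from p q (Suc c) l = diag_arc p q (Suc c) # ts"
    by (cases l) simp_all
  have neq: "diag_arc p q c \<noteq> axis_arc p q c" "axis_arc p q c \<noteq> diag_arc p q (Suc c)"
    by (simp_all add: diag_arc_def axis_arc_def Let_def)
  have IH: "fence_matrix (P_gt p q) (P_wt k p q) (arc_group k (diag_arc p q (Suc c)) @ concat (map (arc_group k) ts)) =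
      line_walk k p q (\<lambda>v. v > 0) (Suc c) l"
    using Suc.IH[of "Suc c"] Suc.prems by (simp add: ts)
  have "fence_matrix (P_gt p q) (P_wt k p q) (concat (map (arc_group k) (arcs_from p q c (Suc l)))) =
      arc_matrix k p q (diag_arc p q c) **
      (link (right_of p q (shared_endpoint (diag_arc p q c) (axis_arc p q c))) **
       arc_matrix k p q (axis_arc p q c) **
       link (right_of p q (shared_endpoint (axis_arc p q c) (diag_arc p q (Suc c))))) **
      line_walk k p q (\<lambda>v. v > 0) (Suc c) l"
    unfolding IH[symmetric]
    by (simp add: ts fence_matrix_group_append[OF neq(1)] fence_matrix_group_append[OF neq(2)] matrix_mul_assoc)
  also have "\<dots> = line_walk k p q (\<lambda>v. v > 0) c (Suc l)"
    using Suc.prems by (simp add: arc_matrix_diag_arc arc_matrix_axis_arc)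
  finally show ?case .
qed

lemma fence_matrix_P_list:
  "fence_matrix (P_gt p q) (P_wt k p q) (P_list k p q) = path_matrix k p q (\<lambda>v. v > 0)"
  unfolding P_list_arc_group crossed_list_eq[OF pq coprime] path_matrix_def
  using pq by (intro fence_matrix_arcs_from) auto

lemma distinct_P_list: "distinct (P_list k p q)" and P_list_nonempty: "P_list k p q \<noteq> []"
proof -
  have "distinct (concat (map (arc_group k) ts))" if "distinct ts" for ts
    using that by (induction ts) (auto simp: arc_group_def split: if_splits)
  then show "distinct (P_list k p q)"
    unfolding P_list_arc_group using distinct_crossed_list[OF pq coprime] .
  have "crossed_list p q \<noteq> []"
    unfolding crossed_list_eq[OF pq coprime] by (cases "p + q - 2") simp_all
  then show "P_list k p q \<noteq> []"
    by (cases "crossed_list p q") (auto simp: P_list_arc_group arc_group_def)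
qed

lemma WP_path_matrix:
  fixes k
  defines "N \<equiv> path_matrix k p q (\<lambda>v. v > 0)" and "L \<equiv> hd (P_list k p q)" and "R \<equiv> last (P_list k p q)"
  shows "WP k p q {} = N $ 1 $ 1 + N $ 1 $ 2 + N $ 2 $ 1 + N $ 2 $ 2"
    and "WP k p q {L} = N $ 1 $ 1 + N $ 1 $ 2"
    and "WP k p q {R} = N $ 1 $ 1 + N $ 2 $ 1"
    and "WP k p q {L, R} = N $ 1 $ 1"
  unfolding WP_def N_def L_def R_def fence_matrix_P_list[symmetric]
  by (rule weight_poly_fence_matrix[OF distinct_P_list P_list_nonempty])+

end

section \<open>The matrices at a Farey vertex\<close>

definition adjugate2 :: "mat2 \<Rightarrow> mat2" where
  "adjugate2 A = vector [vector [A $ 2 $ 2, - (A $ 1 $ 2)], vector [- (A $ 2 $ 1), A $ 1 $ 1]]"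

text \<open>Around the transposed transfer matrix, the first row here sums over the membership of
  the last element and the second row forbids it. In \<open>right_factor\<close> the first column
  forbids the first element and the second column sums over it.\<close>

definition left_factor :: mat2 where
  "left_factor = vector [vector [1, 1], vector [- (x\<^sub>1 / (x\<^sub>2 * x\<^sub>3)), 0]]"

definition right_factor :: mat2 where
  "right_factor = vector [vector [1, x\<^sub>2 * x\<^sub>3 / x\<^sub>1], vector [0, x\<^sub>2 * x\<^sub>3 / x\<^sub>1]]"

definition scalar :: "nat \<Rightarrow> nat \<Rightarrow> ratfun" where
  "scalar p q = (x\<^sub>1 / x\<^sub>2) ^ q * (x\<^sub>3 / x\<^sub>1) ^ p"

lemma x_nonzero [simp]: "x\<^sub>1 \<noteq> 0" "x\<^sub>2 \<noteq> 0" "x\<^sub>3 \<noteq> 0"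
  using x_pos by (metis less_irrefl)+

lemma xhat_simps: "xhat $ 1 = x\<^sub>2 / x\<^sub>3" "xhat $ 2 = x\<^sub>3 / x\<^sub>1" "xhat $ 3 = x\<^sub>1 / x\<^sub>2"
  by (simp_all add: xhat_def)

lemma mat_mult_nth: "(mat c ** A) $ i $ j = c * (A :: mat2) $ i $ j"
  by (simp add: matrix_matrix_mult_def mat_def if_distrib[of "\<lambda>x. x * _"] sum.delta cong: if_cong)

lemma mat_commute: "(A :: mat2) ** mat c = mat c ** A"
  by (simp add: vec_eq_iff mat_mult_nth)
     (simp add: matrix_matrix_mult_def mat_def if_distrib[of "\<lambda>x. _ * x"] sum.delta cong: if_cong)

lemma monomials:
  "monomial (g_circ p q) = scalar p q"
  "monomial (g_vec p q) = scalar p q * (x\<^sub>2 * x\<^sub>3 / x\<^sub>1)"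
  "monomial (2 *s g_circ p q - g_vec p q) = scalar p q * (x\<^sub>1 / (x\<^sub>2 * x\<^sub>3))"
  by (simp_all add: monomial_def scalar_def g_circ_def g_vec_def power_int_diff power_int_add
      power_int_minus field_simps)

text \<open>The negated adjugate exchanges the diagonal entries up to sign, hence the roles of
  \<open>L\<close> and \<open>R\<close>, which amounts to transposing \<open>N\<close>.\<close>

lemma M_pos_path_matrix:
  fixes k :: "nat^3"
  assumes "p > 0" "q > 0" "coprime p q"
  defines "N \<equiv> path_matrix k p q (\<lambda>v. v > 0)"
  shows "M k p q = mat (scalar p q) ** (left_factor ** transpose N ** right_factor)"
    and "- adjugate2 (M k p q) = mat (scalar p q) ** (left_factor ** N ** right_factor)"
  using assms(1,2)
  by (simp_all add: M_def M_pos_def Let_def WP_path_matrix[OF assms(1-3)] monomials N_def[symmetric]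
      vec_eq_iff forall_2 mat_mult_nth)
     (simp_all add: adjugate2_def matrix_matrix_mult_def sum_2 left_factor_def right_factor_def
      transpose_def algebra_simps add_divide_distrib)

text \<open>The arcs around the common point \<open>(q, p)\<close> assemble to
  \<open>T_matrix\<close>; this is where the Markov constant comes from.\<close>

lemma T_middle:
  "right_factor ** T_matrix k ** left_factor =
    horizontal_matrix k True ** group_matrix (k $ 1) (xhat $ 1) True ** vertical_matrix k True"
  by (simp add: vec_eq_iff forall_2 matrix_matrix_mult_def sum_2 left_factor_def right_factor_def
      T_matrix_def horizontal_matrix_def vertical_matrix_def group_matrix_def link_def xhat_simps
      markov_const_def)
     (simp add: field_simps power2_eq_square)

text \<open>Like the next two lemmas, a boundary form of \<open>T_middle\<close>: \<open>0/1\<close>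
  and \<open>1/0\<close> have explicit matrices instead of walks, and the horizontal or vertical
  factor drops out.\<close>

lemma T_first:
  "- adjugate2 (M_01 k) ** T_matrix k ** left_factor =
    mat (scalar 0 1) ** left_factor ** group_matrix (k $ 1) (xhat $ 1) True ** vertical_matrix k True"
  by (simp add: vec_eq_iff forall_2 matrix_matrix_mult_def sum_2 left_factor_def right_factor_def
      T_matrix_def vertical_matrix_def group_matrix_def link_def xhat_simps
      markov_const_def adjugate2_def M_01_def mat_def scalar_def)
     (simp add: field_simps power2_eq_square)

lemma T_last:
  "right_factor ** T_matrix k ** - adjugate2 (M_10 k) =
    mat (scalar 1 0) ** horizontal_matrix k True ** group_matrix (k $ 1) (xhat $ 1) True ** right_factor"
  by (simp add: vec_eq_iff forall_2 matrix_matrix_mult_def sum_2 left_factor_def right_factor_def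
      T_matrix_def horizontal_matrix_def group_matrix_def link_def xhat_simps
      markov_const_def adjugate2_def M_10_def mat_def scalar_def)
     (simp add: field_simps power2_eq_square)

lemma T_first_last:
  "- adjugate2 (M_01 k) ** T_matrix k ** - adjugate2 (M_10 k) =
    mat (scalar 1 1) ** left_factor ** group_matrix (k $ 1) (xhat $ 1) True ** right_factor"
  by (simp add: vec_eq_iff forall_2 matrix_matrix_mult_def sum_2 left_factor_def right_factor_def
      T_matrix_def group_matrix_def link_def xhat_simps
      markov_const_def adjugate2_def M_01_def M_10_def mat_def scalar_def)
     (simp add: field_simps power2_eq_square)

section \<open>The product identity at a mediant\<close>

lemma adjugate2_mult:
  "A ** adjugate2 A = mat (det A)" "adjugate2 A ** A = mat (det A)"
  by (simp_all add: vec_eq_iff forall_2 matrix_matrix_mult_def sum_2 adjugate2_def mat_def det_2 algebra_simps)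

lemma scalar_mult_left: "(A :: mat2) ** (mat c ** B) = mat c ** (A ** (B :: mat2))"
  unfolding matrix_mul_assoc mat_commute[of A] ..

lemma mat_mult_mat: "mat a ** mat b = (mat (a * b) :: mat2)"
  by (simp add: vec_eq_iff mat_mult_nth) (simp add: mat_def)

lemma M_mediant:
  assumes det: "q * r = p * s + 1"
  shows "M k (p + r) (q + s) = - adjugate2 (M k p q) ** T_matrix k ** - adjugate2 (M k r s)"
proof -
  let ?F = "\<lambda>v::int. v > 0" and ?P = left_factor and ?Q = right_factor and ?T = "T_matrix k"
  let ?X = "path_matrix k p q ?F" and ?Z = "path_matrix k r s ?F"
  let ?H = "horizontal_matrix k True" and ?V = "vertical_matrix k True"
  let ?G = "group_matrix (k $ 1) (xhat $ 1) True"
  have pos: "q > 0" "r > 0" using qr_pos[OF det] .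
  \<comment> \<open>The mediant and the second fraction are again Farey neighbours, so the mediant
    is reduced.\<close>
  have det': "(q + s) * r = (p + r) * s + 1" using det by (simp add: algebra_simps)
  \<comment> \<open>The transposed strict path matrix is the weak one, which is the version that
    factors at the mediant.\<close>
  have "M k (p + r) (q + s) = mat (scalar (p + r) (q + s)) **
      (?P ** path_matrix k (p + r) (q + s) (\<lambda>v. v \<ge> 0) ** ?Q)"
    using pos coprime_if_det(1)[OF det'] by (simp add: M_pos_path_matrix path_matrix_transpose)
  also have "\<dots> = mat (scalar p q) ** (mat (scalar r s) ** (?P **
      ((if p = 0 then mat 1 else ?X ** ?H) ** ?G ** (if s = 0 then mat 1 else ?V ** ?Z)) ** ?Q))"
    by (simp add: path_matrix_mediant[OF det] matrix_mul_assoc mat_mult_mat)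
       (simp add: scalar_def power_add mult_ac)
  also have "\<dots> = - adjugate2 (M k p q) ** ?T ** - adjugate2 (M k r s)"
  proof -
    have X: "- adjugate2 (M k p q) = mat (scalar p q) ** (?P ** ?X ** ?Q)" if "p \<noteq> 0"
      using that pos coprime_if_det(1)[OF det] by (simp add: M_pos_path_matrix(2))
    have Z: "- adjugate2 (M k r s) = mat (scalar r s) ** (?P ** ?Z ** ?Q)" if "s \<noteq> 0"
      using that pos coprime_if_det(2)[OF det] by (simp add: M_pos_path_matrix(2))
    have p0: "M k p q = M_01 k" "q = 1" "r = 1" if "p = 0" using that det by (auto simp: M_def)
    have s0: "M k r s = M_10 k" "q = 1" "r = 1" if "s = 0" using that det by (auto simp: M_def)
    let ?a = "mat (scalar p q) :: mat2" and ?b = "mat (scalar r s) :: mat2"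
    have swap: "?b ** (?a ** A) = ?a ** (?b ** A)" for A :: mat2
      by (rule scalar_mult_left)
    consider "p = 0" "s = 0" | "p = 0" "s \<noteq> 0" | "p \<noteq> 0" "s = 0" | "p \<noteq> 0" "s \<noteq> 0" by blast
    then show ?thesis
    proof cases
      case 1
      have "?a ** (?b ** (?P ** (mat 1 ** ?G ** mat 1) ** ?Q)) = mat (scalar 1 1) ** ?P ** ?G ** ?Q"
        using p0(2,3)[OF 1(1)] 1
        by (simp add: matrix_mul_assoc mat_mult_mat) (simp add: scalar_def)
      then show ?thesis
        unfolding p0(1)[OF 1(1)] s0(1)[OF 1(2)] T_first_last using 1 by simp
    next
      case 2
      have "- adjugate2 (M k p q) ** ?T ** - adjugate2 (M k r s) =
          ?b ** ((- adjugate2 (M_01 k) ** ?T ** ?P) ** (?Z ** ?Q))"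
        unfolding p0(1)[OF 2(1)] Z[OF 2(2)] scalar_mult_left[of "_ ** ?T"]
        by (simp only: matrix_mul_assoc)
      also have "\<dots> = ?b ** (?a ** (?P ** (mat 1 ** ?G ** (?V ** ?Z)) ** ?Q))"
        unfolding T_first 2(1) p0(2)[OF 2(1)] by (simp only: matrix_mul_assoc matrix_mul_rid)
      also note swap
      finally show ?thesis using 2 by (simp only: if_True if_False simp_thms)
    next
      case 3
      have "- adjugate2 (M k p q) ** ?T ** - adjugate2 (M k r s) =
          ?a ** (?P ** ?X ** (?Q ** ?T ** - adjugate2 (M_10 k)))"
        unfolding s0(1)[OF 3(2)] X[OF 3(1)] by (simp only: matrix_mul_assoc)
      also have "\<dots> = ?a ** (?P ** ?X ** (?b ** (?H ** ?G ** ?Q)))"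
        unfolding T_last 3(2) s0(3)[OF 3(2)] by (simp only: matrix_mul_assoc)
      also have "\<dots> = ?a ** (?b ** (?P ** ((?X ** ?H) ** ?G ** mat 1) ** ?Q))"
        unfolding scalar_mult_left[of "?P ** ?X"] by (simp only: matrix_mul_assoc matrix_mul_rid)
      finally show ?thesis using 3 by (simp only: if_True if_False simp_thms)
    next
      case 4
      have "- adjugate2 (M k p q) ** ?T ** - adjugate2 (M k r s) =
          ?b ** (?a ** (?P ** ?X ** (?Q ** ?T ** ?P) ** (?Z ** ?Q)))"
        unfolding X[OF 4(1)] Z[OF 4(2)] scalar_mult_left[of "_ ** ?T"]
        by (simp only: matrix_mul_assoc)
      also have "\<dots> = ?b ** (?a ** (?P ** ((?X ** ?H) ** ?G ** (?V ** ?Z)) ** ?Q))"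
        unfolding T_middle by (simp only: matrix_mul_assoc)
      also note swap
      finally show ?thesis using 4 by (simp only: if_False simp_thms)
    qed
  qed
  finally show ?thesis .
qed

lemma neg_adjugate2_inverse:
  assumes "det A = 1"
  shows "A ** (- adjugate2 A) = - mat 1" "(- adjugate2 A) ** A = - mat 1"
proof -
  have neg: "- B = mat (- 1) ** B" for B :: mat2 by (simp add: vec_eq_iff mat_mult_nth)
  show "A ** (- adjugate2 A) = - mat 1" "(- adjugate2 A) ** A = - mat 1"
    unfolding neg[of "adjugate2 A"] neg[of "mat 1"] scalar_mult_left matrix_mul_assoc[symmetric]
    using assms by (simp_all add: adjugate2_mult)
qed

lemma M_mediant_product:
  assumes "q * r = p * s + 1" "det (M k p q) = 1" "det (M k r s) = 1"
  shows "M k p q ** M k (p + r) (q + s) ** M k r s = T_matrix k"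
proof -
  have "M k p q ** M k (p + r) (q + s) ** M k r s =
      (M k p q ** - adjugate2 (M k p q)) ** T_matrix k ** (- adjugate2 (M k r s) ** M k r s)"
    unfolding M_mediant[OF assms(1)] by (simp only: matrix_mul_assoc)
  \<comment> \<open>Both outer brackets equal \<open>- mat 1\<close>, so the signs cancel.\<close>
  also have "\<dots> = T_matrix k"
    unfolding neg_adjugate2_inverse[OF assms(2)] neg_adjugate2_inverse[OF assms(3)]
    by (simp add: vec_eq_iff matrix_matrix_mult_def mat_def sum_2 forall_2)
  finally show ?thesis .
qed

section \<open>Laurent entries and the matrices at the root\<close>

definition laurent_matrix :: "mat2 \<Rightarrow> bool" where
  "laurent_matrix A \<longleftrightarrow> (\<forall>i j. A $ i $ j \<in> laurent)"

lemma laurent_of_nat [simp]: "of_nat n \<in> laurent"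
  using laurent.const[of "int n"] by simp

lemma laurent_0 [simp]: "0 \<in> laurent" and laurent_1 [simp]: "1 \<in> laurent"
  using laurent.const[of 0] laurent.const[of 1] by simp_all

lemma laurent_minus [simp]: "f \<in> laurent \<Longrightarrow> - f \<in> laurent"
  using laurent.mult[OF laurent.const[of "- 1"]] by simp

lemma laurent_diff [simp]: "f \<in> laurent \<Longrightarrow> g \<in> laurent \<Longrightarrow> f - g \<in> laurent"
  using laurent.add[of f "- g"] by simp

lemma laurent_x [simp]: "x\<^sub>1 \<in> laurent" "x\<^sub>2 \<in> laurent" "x\<^sub>3 \<in> laurent"
  "inverse x\<^sub>1 \<in> laurent" "inverse x\<^sub>2 \<in> laurent" "inverse x\<^sub>3 \<in> laurent"
  by (simp_all add: laurent.var laurent.var_inverse)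

lemmas laurent_closure = laurent.add laurent.mult

lemma laurent_matrix_mult: "laurent_matrix A \<Longrightarrow> laurent_matrix B \<Longrightarrow> laurent_matrix (A ** B)"
  by (simp add: laurent_matrix_def matrix_matrix_mult_def sum_2 laurent_closure)

lemma laurent_matrix_adjugate2: "laurent_matrix A \<Longrightarrow> laurent_matrix (adjugate2 A)"
  by (simp add: laurent_matrix_def adjugate2_def forall_2)

lemma laurent_matrix_uminus: "laurent_matrix A \<Longrightarrow> laurent_matrix (- A)"
  by (simp add: laurent_matrix_def)

lemma laurent_matrix_T: "laurent_matrix (T_matrix k)"
  by (simp add: laurent_matrix_def T_matrix_def forall_2 markov_const_def divide_inverse
      power2_eq_square laurent_closure)

lemma laurent_matrix_M_01: "laurent_matrix (M_01 k)" and laurent_matrix_M_10: "laurent_matrix (M_10 k)"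
  by (simp_all add: laurent_matrix_def M_01_def M_10_def forall_2 divide_inverse
      power2_eq_square laurent_closure)

lemma trace_2: "trace (A :: mat2) = A $ 1 $ 1 + A $ 2 $ 2"
  by (simp add: trace_def sum_2)

lemma det_M_01: "det (M_01 k) = 1" and det_M_10: "det (M_10 k) = 1"
  and trace_M_01: "trace (M_01 k) = - of_nat (k $ 3)" and trace_M_10: "trace (M_10 k) = - of_nat (k $ 2)"
  by (simp_all add: det_2 trace_2 M_01_def M_10_def field_simps power2_eq_square)

lemma M_11:
  shows "M k 1 1 = mat (scalar 1 1) ** left_factor ** group_matrix (k $ 1) (xhat $ 1) True ** right_factor"
proof -
  have "M k 1 1 = - adjugate2 (M_01 k) ** T_matrix k ** - adjugate2 (M_10 k)"
    \<comment> \<open>The pair \<open>0/1\<close>, \<open>1/0\<close> is a case of the mediant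
      formula, which spares evaluating the poset of \<open>1/1\<close>.\<close>
    using M_mediant[of 1 1 0 0 k] by (simp add: M_def)
  then show ?thesis by (simp only: T_first_last)
qed

lemma M_11_entries:
  "det (M k 1 1) = 1" "trace (M k 1 1) = - of_nat (k $ 1)"
  "M k 1 1 $ 1 $ 2 = (x\<^sub>2^2 + of_nat (k $ 1) * x\<^sub>2 * x\<^sub>3 + x\<^sub>3^2) / x\<^sub>1"
  unfolding M_11 det_2 trace_2
  by (simp_all add: matrix_matrix_mult_def sum_2 left_factor_def right_factor_def mat_def scalar_def
      group_matrix_def xhat_simps field_simps power2_eq_square)

text \<open>The invariant for the Farey tree. It names a labeled cluster and the positions of the
  three entries instead of using \<open>parity\<close>, so that cluster and traces can be updated
  together.\<close>

definition markov_seed :: "nat^3 \<Rightarrow> mat2 \<Rightarrow> mat2 \<Rightarrow> mat2 \<Rightarrow> bool" where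
  "markov_seed k X Y Z \<longleftrightarrow> X ** Y ** Z = T_matrix k \<and>
     (\<forall>A \<in> {X, Y, Z}. laurent_matrix A \<and> det A = 1) \<and>
     (\<exists>c \<in> labeled_clusters k. \<exists>i j l. i \<noteq> j \<and> i \<noteq> l \<and> j \<noteq> l \<and>
       X $ 1 $ 2 = c $ i \<and> Y $ 1 $ 2 = c $ j \<and> Z $ 1 $ 2 = c $ l \<and>
       trace X = - of_nat (k $ i) \<and> trace Y = - of_nat (k $ j) \<and> trace Z = - of_nat (k $ l))"

lemma markov_seedI:
  assumes "X ** Y ** Z = T_matrix k" "laurent_matrix X" "laurent_matrix Y" "laurent_matrix Z"
    "det X = 1" "det Y = 1" "det Z = 1"
    "c \<in> labeled_clusters k" "i \<noteq> j" "i \<noteq> l" "j \<noteq> l"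
    "X $ 1 $ 2 = c $ i" "Y $ 1 $ 2 = c $ j" "Z $ 1 $ 2 = c $ l"
    "trace X = - of_nat (k $ i)" "trace Y = - of_nat (k $ j)" "trace Z = - of_nat (k $ l)"
  shows "markov_seed k X Y Z"
proof -
  have "\<exists>i j l. i \<noteq> j \<and> i \<noteq> l \<and> j \<noteq> l \<and>
      X $ 1 $ 2 = c $ i \<and> Y $ 1 $ 2 = c $ j \<and> Z $ 1 $ 2 = c $ l \<and>
      trace X = - of_nat (k $ i) \<and> trace Y = - of_nat (k $ j) \<and> trace Z = - of_nat (k $ l)"
    by (rule exI[of _ i], rule exI[of _ j], rule exI[of _ l]) (use assms(9-) in simp)
  then show ?thesis unfolding markov_seed_def using assms(1-8) by blast
qed

lemma markov_seedD:
  assumes "markov_seed k X Y Z"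
  shows "X ** Y ** Z = T_matrix k" "laurent_matrix X" "laurent_matrix Y" "laurent_matrix Z"
    "det X = 1" "det Y = 1" "det Z = 1"
  using assms[unfolded markov_seed_def, THEN conjunct1]
    assms[unfolded markov_seed_def, THEN conjunct2, THEN conjunct1] by simp_all

lemma markov_seedE:
  assumes "markov_seed k X Y Z"
  obtains c i j l where "c \<in> labeled_clusters k" "i \<noteq> j" "i \<noteq> l" "j \<noteq> l"
    "X $ 1 $ 2 = c $ i" "Y $ 1 $ 2 = c $ j" "Z $ 1 $ 2 = c $ l"
    "trace X = - of_nat (k $ i)" "trace Y = - of_nat (k $ j)" "trace Z = - of_nat (k $ l)"
  using assms[unfolded markov_seed_def, THEN conjunct2, THEN conjunct2] by blast

lemma CMM_matrixI:
  assumes "laurent_matrix A" "det A = 1" "c \<in> labeled_clusters k" "A $ 1 $ 2 = c $ i"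
    "trace A = - of_nat (k $ i)"
  shows "CMM_matrix k A"
  using assms parity_labeled_cluster[OF assms(3)]
  by (auto simp: CMM_matrix_def laurent_matrix_def cluster_variable_def occurs_at_def)

lemma markov_seed_CMM_triple:
  assumes "markov_seed k X Y Z"
  shows "CMM_triple k X Y Z"
proof -
  obtain c i j l where c: "c \<in> labeled_clusters k" "i \<noteq> j" "i \<noteq> l" "j \<noteq> l"
      "X $ 1 $ 2 = c $ i" "Y $ 1 $ 2 = c $ j" "Z $ 1 $ 2 = c $ l"
      "trace X = - of_nat (k $ i)" "trace Y = - of_nat (k $ j)" "trace Z = - of_nat (k $ l)"
    using markov_seedE[OF assms] .
  define \<sigma> :: "3 \<Rightarrow> 3" where "\<sigma> t = (if t = 1 then i else if t = 2 then j else l)" for t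
  have "inj \<sigma>"
  proof (rule injI)
    fix s t assume "\<sigma> s = \<sigma> t"
    then show "s = t" using c(2-4) exhaust_3[of s] exhaust_3[of t] by (auto simp: \<sigma>_def)
  qed
  then have "bij \<sigma>" by (simp add: bij_def finite_UNIV_inj_surj)
  moreover have "vector [X $ 1 $ 2, Y $ 1 $ 2, Z $ 1 $ 2] = (\<chi> t. c $ \<sigma> t)"
    by (simp add: vec_eq_iff forall_3 \<sigma>_def c)
  ultimately have "vector [X $ 1 $ 2, Y $ 1 $ 2, Z $ 1 $ 2] \<in> nonlabeled_clusters k"
    unfolding nonlabeled_clusters_def using c(1) by blast
  moreover have "CMM_matrix k X" "CMM_matrix k Y" "CMM_matrix k Z"
    using markov_seedD[OF assms] c CMM_matrixI by blast+
  ultimately show ?thesis using markov_seedD(1)[OF assms] by (simp add: CMM_triple_def)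
qed

section \<open>Conjugation as mutation\<close>

lemma trace_conjugate:
  assumes "det Y = 1"
  shows "trace (Y ** Z ** adjugate2 Y) = trace Z" "trace (adjugate2 Y ** Z ** Y) = trace Z"
proof -
  have "trace (Y ** Z ** adjugate2 Y) = det Y * trace Z" "trace (adjugate2 Y ** Z ** Y) = det Y * trace Z"
    by (simp_all add: trace_2 det_2 matrix_matrix_mult_def sum_2 adjugate2_def algebra_simps)
  then show "trace (Y ** Z ** adjugate2 Y) = trace Z" "trace (adjugate2 Y ** Z ** Y) = trace Z"
    using assms by simp_all
qed

lemma det_conjugate:
  assumes "det Y = 1"
  shows "det (Y ** Z ** adjugate2 Y) = det Z" "det (adjugate2 Y ** Z ** Y) = det Z"
proof -
  have "det (adjugate2 Y) = det Y" by (simp add: det_2 adjugate2_def mult.commute)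
  then show "det (Y ** Z ** adjugate2 Y) = det Z" "det (adjugate2 Y ** Z ** Y) = det Z"
    using assms by (simp_all add: det_mul)
qed

lemma mult_left_cancel_det:
  fixes A B C :: mat2
  assumes "det A = 1" "A ** B = A ** C"
  shows "B = C"
proof -
  have "(adjugate2 A ** A) ** B = (adjugate2 A ** A) ** C"
    using assms(2) by (simp only: matrix_mul_assoc[symmetric])
  then show ?thesis using assms(1) by (simp add: adjugate2_mult)
qed

lemma mult_right_cancel_det:
  fixes A B C :: mat2
  assumes "det A = 1" "B ** A = C ** A"
  shows "B = C"
proof -
  have "B ** (A ** adjugate2 A) = C ** (A ** adjugate2 A)"
    using assms(2) by (simp only: matrix_mul_assoc)
  then show ?thesis using assms(1) by (simp add: adjugate2_mult)
qed

text \<open>\<open>T_matrix\<close> is lower triangular with diagonal \<open>-1\<close>, so the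
  upper right entry of \<open>Y ** Z = adjugate2 X ** T_matrix k\<close> expresses that of
  \<open>X\<close> through \<open>Y\<close> and \<open>Z\<close>. Substituting this and
  \<open>det Z = 1\<close> yields the exchange polynomial.\<close>

lemma exchange_left:
  assumes "X ** Y ** Z = T_matrix k" "det X = 1" "det Z = 1" "Z $ 1 $ 2 \<noteq> 0"
  shows "(Y ** Z ** adjugate2 Y) $ 1 $ 2 =
    ((X $ 1 $ 2)^2 - trace Z * X $ 1 $ 2 * Y $ 1 $ 2 + (Y $ 1 $ 2)^2) / Z $ 1 $ 2"
proof -
  have "Y ** Z = adjugate2 X ** T_matrix k"
    unfolding assms(1)[symmetric] using assms(2) by (simp add: matrix_mul_assoc adjugate2_mult)
  then have "(Y ** Z) $ 1 $ 2 = (adjugate2 X ** T_matrix k) $ 1 $ 2" by simp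
  then have x: "X $ 1 $ 2 = Y $ 1 $ 1 * Z $ 1 $ 2 + Y $ 1 $ 2 * Z $ 2 $ 2"
    by (simp add: matrix_matrix_mult_def sum_2 adjugate2_def T_matrix_def)
  have d: "Z $ 1 $ 2 * Z $ 2 $ 1 = Z $ 1 $ 1 * Z $ 2 $ 2 - 1"
    using assms(3) by (simp add: det_2)
  have "Z $ 1 $ 2 * (Y ** Z ** adjugate2 Y) $ 1 $ 2 =
      Z $ 1 $ 2 * (Y $ 1 $ 1 * X $ 1 $ 2 - Y $ 1 $ 1 * Y $ 1 $ 2 * Z $ 1 $ 1)
      - (Y $ 1 $ 2)^2 * (Z $ 1 $ 2 * Z $ 2 $ 1)"
    unfolding x by (simp add: matrix_matrix_mult_def sum_2 adjugate2_def algebra_simps power2_eq_square)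
  also have "\<dots> = (X $ 1 $ 2)^2 - trace Z * X $ 1 $ 2 * Y $ 1 $ 2 + (Y $ 1 $ 2)^2"
    unfolding d x trace_2 by (simp add: algebra_simps power2_eq_square)
  finally show ?thesis using assms(4) by (simp add: field_simps)
qed

lemma exchange_right:
  assumes "X ** Y ** Z = T_matrix k" "det X = 1" "det Z = 1" "X $ 1 $ 2 \<noteq> 0"
  shows "(adjugate2 Y ** X ** Y) $ 1 $ 2 =
    ((Y $ 1 $ 2)^2 - trace X * Y $ 1 $ 2 * Z $ 1 $ 2 + (Z $ 1 $ 2)^2) / X $ 1 $ 2"
proof -
  have "X ** Y = T_matrix k ** adjugate2 Z"
    unfolding assms(1)[symmetric] using assms(3)
    by (simp add: adjugate2_mult flip: matrix_mul_assoc)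
  then have "(X ** Y) $ 1 $ 2 = (T_matrix k ** adjugate2 Z) $ 1 $ 2" by simp
  then have z: "Z $ 1 $ 2 = X $ 1 $ 1 * Y $ 1 $ 2 + X $ 1 $ 2 * Y $ 2 $ 2"
    by (simp add: matrix_matrix_mult_def sum_2 adjugate2_def T_matrix_def)
  have d: "X $ 1 $ 2 * X $ 2 $ 1 = X $ 1 $ 1 * X $ 2 $ 2 - 1"
    using assms(2) by (simp add: det_2)
  have "X $ 1 $ 2 * (adjugate2 Y ** X ** Y) $ 1 $ 2 =
      X $ 1 $ 2 * (Y $ 2 $ 2 * Z $ 1 $ 2 - Y $ 1 $ 2 * X $ 2 $ 2 * Y $ 2 $ 2)
      - (Y $ 1 $ 2)^2 * (X $ 1 $ 2 * X $ 2 $ 1)"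
    unfolding z by (simp add: matrix_matrix_mult_def sum_2 adjugate2_def algebra_simps power2_eq_square)
  also have "\<dots> = (Y $ 1 $ 2)^2 - trace X * Y $ 1 $ 2 * Z $ 1 $ 2 + (Z $ 1 $ 2)^2"
    unfolding d z trace_2 by (simp add: algebra_simps power2_eq_square)
  finally show ?thesis using assms(4) by (simp add: field_simps)
qed

text \<open>The product equation alone determines \<open>W\<close>: cancelling \<open>X\<close>
  shows that it is \<open>Z\<close> conjugated by \<open>Y\<close>, and the exchange relation is
  then the mutation at the position of \<open>Z\<close>.\<close>

lemma markov_seed_left:
  assumes "markov_seed k X Y Z" "X ** W ** Y = T_matrix k"
  shows "markov_seed k X W Y"
proof -
  obtain c i j l where c: "c \<in> labeled_clusters k" "i \<noteq> j" "i \<noteq> l" "j \<noteq> l"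
      "X $ 1 $ 2 = c $ i" "Y $ 1 $ 2 = c $ j" "Z $ 1 $ 2 = c $ l"
      "trace X = - of_nat (k $ i)" "trace Y = - of_nat (k $ j)" "trace Z = - of_nat (k $ l)"
    using markov_seedE[OF assms(1)] .
  note T = markov_seedD(1)[OF assms(1)] and A = markov_seedD(2-)[OF assms(1)]
  have "W ** Y = Y ** Z"
    by (rule mult_left_cancel_det[OF A(4)]) (simp add: matrix_mul_assoc assms(2) T)
  also have "\<dots> = Y ** Z ** adjugate2 Y ** Y"
    using A(5) by (simp add: adjugate2_mult flip: matrix_mul_assoc)
  finally have W: "W = Y ** Z ** adjugate2 Y" using A(5) mult_right_cancel_det by blast
  obtain c' where c': "c' \<in> labeled_clusters k" "c' $ i = c $ i" "c' $ j = c $ j"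
      "c' $ l = ((c $ i)^2 + of_nat (k $ l) * c $ i * c $ j + (c $ j)^2) / c $ l"
    using labeled_cluster_mutation[OF c(1) c(3,4)[symmetric] c(2)] .
  \<comment> \<open>Cluster variables are positive in the ordered field, so the exchange relation
    may be divided.\<close>
  have "c $ l \<noteq> 0" using labeled_cluster_pos[OF c(1), of l] by auto
  then have "W $ 1 $ 2 = c' $ l"
    unfolding W using exchange_left[OF T A(4,6)] by (simp add: c c')
  moreover have "trace W = - of_nat (k $ l)" "det W = 1"
    unfolding W using A by (simp_all add: trace_conjugate det_conjugate c)
  moreover have "laurent_matrix W"
    unfolding W using A by (intro laurent_matrix_mult laurent_matrix_adjugate2)
  \<comment> \<open>\<open>W\<close> takes over the position \<open>l\<close> of \<open>Z\<close>,
    hence the order \<open>i l j\<close>.\<close>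
  ultimately show ?thesis
    using assms(2) A c c' by (intro markov_seedI[of _ _ _ _ c' i l j]) simp_all
qed

text \<open>Mirror image of the previous lemma: cancelling \<open>Z\<close> shows that
  \<open>W\<close> is a conjugate of \<open>X\<close>, whose position it inherits.\<close>

lemma markov_seed_right:
  assumes "markov_seed k X Y Z" "Y ** W ** Z = T_matrix k"
  shows "markov_seed k Y W Z"
proof -
  obtain c i j l where c: "c \<in> labeled_clusters k" "i \<noteq> j" "i \<noteq> l" "j \<noteq> l"
      "X $ 1 $ 2 = c $ i" "Y $ 1 $ 2 = c $ j" "Z $ 1 $ 2 = c $ l"
      "trace X = - of_nat (k $ i)" "trace Y = - of_nat (k $ j)" "trace Z = - of_nat (k $ l)"
    using markov_seedE[OF assms(1)] .
  note T = markov_seedD(1)[OF assms(1)] and A = markov_seedD(2-)[OF assms(1)]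
  have "Y ** W = X ** Y"
    by (rule mult_right_cancel_det[OF A(6)]) (simp add: assms(2) T)
  also have "\<dots> = Y ** (adjugate2 Y ** X ** Y)"
    using A(5) by (simp add: adjugate2_mult matrix_mul_assoc)
  finally have W: "W = adjugate2 Y ** X ** Y" using A(5) mult_left_cancel_det by blast
  obtain c' where c': "c' \<in> labeled_clusters k" "c' $ j = c $ j" "c' $ l = c $ l"
      "c' $ i = ((c $ j)^2 + of_nat (k $ i) * c $ j * c $ l + (c $ l)^2) / c $ i"
    using labeled_cluster_mutation[OF c(1-4)] .
  have "c $ i \<noteq> 0" using labeled_cluster_pos[OF c(1), of i] by auto
  then have "W $ 1 $ 2 = c' $ i"
    unfolding W using exchange_right[OF T A(4,6)] by (simp add: c c')
  moreover have "trace W = - of_nat (k $ i)" "det W = 1"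
    unfolding W using A by (simp_all add: trace_conjugate det_conjugate c)
  moreover have "laurent_matrix W"
    unfolding W using A by (intro laurent_matrix_mult laurent_matrix_adjugate2)
  ultimately show ?thesis
    using assms(2) A c c' by (intro markov_seedI[of _ _ _ _ c' j i l]) simp_all
qed

section \<open>Induction over the Farey tree\<close>

lemma markov_seed_root: "markov_seed k (M k 0 1) (M k 1 1) (M k 1 0)"
proof -
  have M: "M k 0 (Suc 0) = M_01 k" "M k (Suc 0) 0 = M_10 k" by (simp_all add: M_def)
  have entries: "M_01 k $ 1 $ 2 = x\<^sub>3" "M_10 k $ 1 $ 2 = x\<^sub>2"
    by (simp_all add: M_01_def M_10_def)
  have "M k 1 1 = - adjugate2 (M_01 k) ** T_matrix k ** - adjugate2 (M_10 k)"
    using M_mediant[of 1 1 0 0 k] by (simp add: M_def)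
  then have "laurent_matrix (M k 1 1)"
    by (simp only:) (intro laurent_matrix_mult laurent_matrix_uminus laurent_matrix_adjugate2
      laurent_matrix_T laurent_matrix_M_01 laurent_matrix_M_10)
  moreover have "M k 0 1 ** M k 1 1 ** M k 1 0 = T_matrix k"
    using M_mediant_product[of 1 1 0 0 k] by (simp add: M_def det_M_01 det_M_10)
  moreover have "mu1 k (vector [x\<^sub>1, x\<^sub>2, x\<^sub>3]) \<in> labeled_clusters k"
    by (intro labeled_clusters.intros)
  \<comment> \<open>The outer matrices carry \<open>x\<^sub>3\<close> and \<open>x\<^sub>2\<close>,
    and \<open>1/1\<close> carries the first mutation of \<open>x\<^sub>1\<close>. So the root
    cluster is \<open>mu1\<close> of the initial one, read in positions 3, 1, 2.\<close>
  ultimately show ?thesis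
    by (intro markov_seedI[of _ _ _ _ "mu1 k (vector [x\<^sub>1, x\<^sub>2, x\<^sub>3])" 3 1 2])
       (simp_all add: M M_11_entries[unfolded One_nat_def] laurent_matrix_M_01 laurent_matrix_M_10
         det_M_01 det_M_10 trace_M_01 trace_M_10 mu1_def entries)
qed

text \<open>The mediant form and the determinant relation are proved along with the seed, because
  the product identity for each child depends on them.\<close>

lemma farey_vertex_markov_seed:
  assumes "farey_vertex (a, b) (c, d) (e, f)"
  shows "c = a + e \<and> d = b + f \<and> b * e = a * f + 1 \<and>
    markov_seed k (M k a b) (M k c d) (M k e f)"
  using assms
proof (induction "(a, b)" "(c, d)" "(e, f)" arbitrary: a b c d e f rule: farey_vertex.induct)
  case root
  then show ?case using markov_seed_root by simp
next
  case (left_child a b c d e f)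
  then have IH: "c = a + e" "d = b + f" "b * e = a * f + 1" "markov_seed k (M k a b) (M k c d) (M k e f)"
    by auto
  have det: "b * c = a * d + 1" using IH(1-3) by (simp add: algebra_simps)
  have "M k a b ** M k (a + c) (b + d) ** M k c d = T_matrix k"
    using markov_seedD[OF IH(4)] by (intro M_mediant_product det)
  then show ?case using markov_seed_left[OF IH(4)] det by simp
next
  case (right_child a b c d e f)
  then have IH: "c = a + e" "d = b + f" "b * e = a * f + 1" "markov_seed k (M k a b) (M k c d) (M k e f)"
    by auto
  have det: "d * e = c * f + 1" using IH(1-3) by (simp add: algebra_simps)
  have "M k c d ** M k (c + e) (d + f) ** M k e f = T_matrix k"
    using markov_seedD[OF IH(4)] by (intro M_mediant_product det)
  then show ?case using markov_seed_right[OF IH(4)] det by simp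
qed

text \<open>Subtractive Euclidean algorithm: for \<open>i > j\<close> the combination equals
  \<open>(i - j) * a + j * (a + e)\<close>, a smaller instance at the left child; for
  \<open>i < j\<close> the right child serves. Coprimality makes it stop at
  \<open>i = j = 1\<close>.\<close>

lemma farey_vertex_descend:
  assumes "farey_vertex (a, b) (a + e, b + f) (e, f)" "i > 0" "j > 0" "coprime i j"
  shows "\<exists>u w. farey_vertex u (i * a + j * e, i * b + j * f) w"
  using assms
proof (induction "i + j" arbitrary: a b e f i j rule: less_induct)
  case less
  consider "i = j" | "i > j" | "i < j" by linarith
  then show ?case
  proof cases
    case 1
    then have "i = 1" "j = 1" using less.prems by auto
    then show ?thesis using less.prems(1) by auto
  next
    case 2
    then obtain t where t: "t > 0" "i = t + j" by (metis less_imp_add_positive add.commute)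
    have "coprime t j" using less.prems(4) by (simp add: t(2) coprime_iff_gcd_eq_1)
    then have "\<exists>u w. farey_vertex u (t * a + j * (a + e), t * b + j * (b + f)) w"
      using t less.prems by (intro less.hyps farey_vertex.left_child) auto
    moreover have "t * x + j * (x + y) = i * x + j * y" for x y
      by (simp add: t(2) algebra_simps)
    ultimately show ?thesis by simp
  next
    case 3
    then obtain t where t: "t > 0" "j = i + t" by (metis less_imp_add_positive)
    have "coprime i t" using less.prems(4) by (simp add: t(2) coprime_iff_gcd_eq_1)
    then have "\<exists>u w. farey_vertex u (i * (a + e) + t * e, i * (b + f) + t * f) w"
      using t less.prems by (intro less.hyps farey_vertex.right_child) auto
    moreover have "i * (x + y) + t * y = i * x + j * y" for x y
      by (simp add: t(2) algebra_simps)
    ultimately show ?thesis by simp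
  qed
qed

theorem theorem10p1:
  fixes k :: "nat^3"
  shows "(\<forall>p q. coprime p q \<longrightarrow> CMM_matrix k (M k p q)) \<and>
    (\<forall>p q r s. farey_vertex (p, q) (p + r, q + s) (r, s) \<longrightarrow>
       CMM_triple k (M k p q) (M k (p + r) (q + s)) (M k r s))"
proof -
  have vertex: "CMM_triple k (M k a b) (M k c d) (M k e f)" if "farey_vertex (a, b) (c, d) (e, f)" for a b c d e f
    using farey_vertex_markov_seed[OF that, of k] markov_seed_CMM_triple by blast
  have "CMM_matrix k (M k p q)" if pq: "coprime p q" for p q
  proof -
    consider "p = 0" "q = 1" | "p = 1" "q = 0" | "p > 0" "q > 0"
      using pq by (cases "p = 0"; cases "q = 0") auto
    then show ?thesis
    proof cases
      case 3
      \<comment> \<open>At the root the outer pairs are \<open>(0, 1)\<close> and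
        \<open>(1, 0)\<close>, so the coefficients \<open>q\<close> and \<open>p\<close> produce
        \<open>(p, q)\<close>.\<close>
      then obtain u w where "farey_vertex u (p, q) w"
        using farey_vertex_descend[of 0 1 1 0 q p] farey_vertex.root pq by (auto simp: coprime_commute)
      then show ?thesis
        using vertex by (metis CMM_triple_def surj_pair)
    qed (use vertex[OF farey_vertex.root] in \<open>simp_all add: CMM_triple_def\<close>)
  qed
  then show ?thesis using vertex by blast
qed

end
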